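(* Let $r,s$ be positive integers, and let $$\Phi_s(z) := \sum_{i = 0}^s (-1)^{s - i} z^{\underline{s - i}}\, p_{s, i} \in \mathbb{Q}[z],\qquad p_{s, i} := \frac{\binom{s}{i}}{2^i}\, \frac{ (r + i - 1)^{\underline{\lfloor i / 2 \rfloor}}\, (r + 1)^{\overline{i}} }{ (r + 1 / 2)^{\overline{\lfloor i / 2 \rfloor}} }.$$ If $\Phi_s$ has only integer zeros (i.e. all its complex zeros are integers), then either $s=1$, or $r=1$, or $s\ge 5000\,r\,(14.5+\ln r)^2$.
   Context: Falling and rising factorials: $x^{\underline{k}}=x(x-1)\cdots(x-k+1)$ and $x^{\overline{k}}=x(x+1)\cdots(x+k-1)$, with $x^{\underline{0}}=x^{\overline{0}}=1$. $\ln$ is the natural logarithm. *)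

theory Defs
  imports Complex_Main "HOL-Computational_Algebra.Polynomial"
begin

(* The rising factorial is pochhammer.  The falling factorial is stated for an
   arbitrary commutative ring, so that it applies both to rational numbers and
   to the indeterminate [:0, 1:] of a polynomial ring. *)
definition ffact :: "nat \<Rightarrow> 'a::comm_ring_1 \<Rightarrow> 'a" where
  "ffact k x = (\<Prod>j<k. x - of_nat j)"

definition pcoeff :: "nat \<Rightarrow> nat \<Rightarrow> nat \<Rightarrow> rat" where
  "pcoeff r s i = of_nat (s choose i) / 2 ^ i *
     (ffact (i div 2) (of_nat r + of_nat i - 1) * pochhammer (of_nat r + 1) i
       / pochhammer (of_nat r + 1 / 2) (i div 2))"

definition Phi :: "nat \<Rightarrow> nat \<Rightarrow> rat poly" where
  "Phi r s = (\<Sum>i\<le>s. smult ((-1) ^ (s - i) * pcoeff r s i) (ffact (s - i) [:0, 1:]))"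

lemma poly_ffact: "poly (ffact k p) x = ffact k (poly p x)"
  by (simp add: ffact_def poly_prod)

end

theory Submission
  imports Defs "HOL-Number_Theory.Cong"
    "HOL-Computational_Algebra.Fundamental_Theorem_Algebra" "HOL-Library.Code_Binary_Nat"
begin

text \<open>
  A polynomial with rational coefficients and leading coefficient \<open>1\<close> or \<open>-1\<close> whose zeros
  are integers has integer coefficients. The falling factorials are monic with integer
  coefficients, so every coefficient \<open>pcoeff r s i\<close> of \<open>Phi r s\<close> in that basis is an
  integer too (\<open>pcoeff_in_Ints\<close>). This already rules out \<open>r \<ge> 2\<close> together with \<open>s \<ge> 2\<close>,
  for all sizes of \<open>s\<close> (\<open>no_integral_coefficients\<close>), and the theorem follows.

  The contradiction is found in the denominators. For \<open>i = 2 * j\<close> they contain the odd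
  numbers \<open>2 * r + 1, 2 * r + 3, ..., 2 * r + 2 * j - 1\<close>. Let a prime \<open>p\<close> divide
  \<open>2 * r + d\<close> with \<open>d\<close> odd and \<open>p \<ge> d + 4\<close>, and take \<open>i = d + 1\<close>. The numerator consists
  of the binomial coefficient and of factors \<open>r + l\<close> with \<open>1 \<le> l \<le> d + 1\<close>; if \<open>p\<close> divided
  such a factor, it would divide the odd number \<open>2 * l - d\<close>, whose absolute value is at
  most \<open>d + 2\<close>. So \<open>p\<close> divides the binomial coefficient, which is false as soon as
  \<open>s mod p \<ge> d + 1\<close> (\<open>residue_constraint\<close>). It remains to find a suitable prime:

  \<^item> if \<open>s \<ge> 2 * r - 1\<close>, any prime \<open>p > 2 * r\<close> that divides one of
  \<open>s + 1, ..., s + 2 * r - 1\<close> will do, with \<open>d = p - 2 * r\<close> (\<open>window_prime_factor\<close>);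

  \<^item> if \<open>s < 2 * r - 1\<close>, put \<open>m = s div 2\<close>; any prime \<open>p > 2 * m + 1\<close> that divides one of
  the \<open>m\<close> odd numbers following \<open>2 * r\<close> will do.

  Both primes come from a theorem of Schur (\<open>odd_window_prime_factor\<close>): for \<open>m \<ge> 2\<close>, any
  \<open>m\<close> consecutive odd numbers greater than \<open>2 * m + 1\<close> include a multiple of a prime
  greater than \<open>2 * m + 1\<close>, except \<open>25, 27\<close>. It is proved here for windows whose largest
  member \<open>N\<close> is at most \<open>12 * m\<^sup>2 + 8 * m\<close>. In the second case this bound holds because
  integrality of \<open>pcoeff r s 2\<close> makes \<open>2 * r + 1\<close> divide \<open>3 * (s choose 2)\<close>; in the first
  case larger windows are settled by comparing the size of a binomial coefficient with the
  number of primes (\<open>long_window_prime_factor\<close>). The small parameters \<open>s = 2\<close>, \<open>s = 3\<close> and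
  the exceptional window are treated directly.

  The proof of Schur's theorem follows Erdos. Let \<open>P\<close> be the product of the window and
  \<open>Q = 1 * 3 * ... * (2 * m - 1)\<close>. A prime power \<open>p ^ t\<close> has at most one multiple more in
  the window than among the factors of \<open>Q\<close>. If all prime factors of \<open>P\<close> are at most
  \<open>2 * m + 1\<close>, then \<open>P / Q\<close> is at most the product, over the odd primes up to \<open>2 * m + 1\<close>,
  of \<open>p\<close> to the number of those \<open>t\<close> for which there is such an additional multiple; this
  power of \<open>p\<close> is at most \<open>N\<close>. On the other hand \<open>P / Q\<close> is at least \<open>(N / m) ^ m / 2\<close>.
  The comparison gives \<open>N\<^sup>2 \<le> 192 * m ^ 3\<close> for \<open>m \<ge> 24\<close> and \<open>N\<^sup>2 \<le> 2 * m ^ 3\<close> for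
  \<open>m \<ge> 192\<close>, so that for \<open>m < 2048\<close> explicit chains of primes with small gaps meet all
  windows that are left. For \<open>m \<ge> 2048\<close> the bound is sharpened: of the primes between
  \<open>sqrt N\<close> and \<open>2 * m\<close> only those up to \<open>M = min m (N / 5)\<close> contribute, altogether at most
  \<open>4 ^ M\<close> by Chebyshev's estimate, and there are few primes up to \<open>sqrt N\<close>.
\<close>

section \<open>Multiples of prime powers in arithmetic progressions\<close>

definition ap_prod :: "nat \<Rightarrow> nat \<Rightarrow> nat \<Rightarrow> nat" where
  "ap_prod b d m = (\<Prod>j<m. b + d * j)"

definition ap_count :: "nat \<Rightarrow> nat \<Rightarrow> nat \<Rightarrow> nat \<Rightarrow> nat" where
  "ap_count b d m q = card {j. j < m \<and> q dvd b + d * j}"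

lemma coprime_dvd_ap_diff:
  fixes q d :: nat
  assumes "coprime q d" "q dvd b + d * i" "q dvd b + d * j" "i \<le> j"
  shows "q dvd j - i"
proof -
  have "q dvd (b + d * j) - (b + d * i)"
    using assms by (intro dvd_diff_nat) auto
  also have "(b + d * j) - (b + d * i) = d * (j - i)"
    by (simp add: diff_mult_distrib2)
  finally show ?thesis
    using assms(1) coprime_dvd_mult_right_iff by blast
qed

text \<open>
  Two multiples of \<open>q\<close> in the progression have indices that differ by a multiple of \<open>q\<close>,
  so each of the at most \<open>m div q + 1\<close> blocks of \<open>q\<close> consecutive indices contains at most
  one.
\<close>
lemma ap_count_upper:
  assumes "coprime q d" "q > 0"
  shows "ap_count b d m q \<le> m div q + 1"
proof -
  let ?A = "{j. j < m \<and> q dvd b + d * j}"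
  have inj: "inj_on (\<lambda>j. j div q) ?A"
  proof (rule inj_onI)
    fix i j assume ij: "i \<in> ?A" "j \<in> ?A" "i div q = j div q"
    have "i mod q = j mod q"
    proof (cases "i \<le> j")
      case True
      hence "q dvd j - i" using ij assms coprime_dvd_ap_diff[of q d b i j] by blast
      thus ?thesis using True by (metis mod_eq_dvd_iff_nat)
    next
      case False
      hence "q dvd i - j" using ij assms coprime_dvd_ap_diff[of q d b j i] by auto
      thus ?thesis using False by (metis mod_eq_dvd_iff_nat nat_le_linear)
    qed
    with ij show "i = j"
      by (metis div_mult_mod_eq)
  qed
  have "(\<lambda>j. j div q) ` ?A \<subseteq> {..m div q}"
    by (auto intro: div_le_mono)
  hence "card ?A \<le> card {..m div q}"
    by (intro card_inj_on_le[OF inj]) auto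
  thus ?thesis by (simp add: ap_count_def)
qed

text \<open>
  Each complete block of \<open>q\<close> consecutive indices contains a multiple of \<open>q\<close>, because \<open>d\<close>
  is invertible modulo \<open>q\<close>.
\<close>
lemma ap_count_lower:
  assumes "coprime q d" "q > 0"
  shows "m div q \<le> ap_count b d m q"
proof -
  obtain x where x: "[d * x = Suc 0] (mod q)"
    using assms cong_solve_coprime_nat coprime_commute by blast
  \<comment> \<open>\<open>y\<close> solves \<open>b + d * y = 0\<close> modulo \<open>q\<close>, as \<open>q - 1\<close> represents \<open>-1\<close>.\<close>
  define y where "y = x * ((q - 1) * b) mod q"
  have y: "y < q" using assms by (simp add: y_def)
  have "[d * y = d * (x * ((q - 1) * b))] (mod q)"
    unfolding y_def cong_def by (simp add: mod_mult_right_eq)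
  also have "d * (x * ((q - 1) * b)) = (d * x) * ((q - 1) * b)" by simp
  also have "[\<dots> = Suc 0 * ((q - 1) * b)] (mod q)"
    by (intro cong_mult x cong_refl)
  finally have "[b + d * y = b + (q - 1) * b] (mod q)"
    by (intro cong_add cong_refl) simp
  also have "b + (q - 1) * b = q * b"
    using assms by (cases q) auto
  finally have qy: "q dvd b + d * y"
    by (metis cong_dvd_iff dvd_triv_left)
  let ?A = "{j. j < m \<and> q dvd b + d * j}"
  have "(\<lambda>t. t * q + y) ` {..<m div q} \<subseteq> ?A"
  proof (rule image_subsetI)
    fix t assume "t \<in> {..<m div q}"
    hence "Suc t \<le> m div q" by simp
    hence "Suc t * q \<le> m div q * q"
      by (rule mult_le_mono1)
    also have "\<dots> \<le> m" by simp
    finally have "t * q + y < m" using y by simp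
    moreover have "b + d * (t * q + y) = (b + d * y) + q * (d * t)" by (simp add: algebra_simps)
    hence "q dvd b + d * (t * q + y)" using qy by (metis dvd_add dvd_triv_left)
    ultimately show "t * q + y \<in> ?A" by simp
  qed
  moreover have "inj_on (\<lambda>t. t * q + y) {..<m div q}"
    using assms by (auto intro: inj_onI)
  ultimately have "card {..<m div q} \<le> card ?A"
    by (intro card_inj_on_le) auto
  thus ?thesis by (simp add: ap_count_def)
qed

text \<open>
  Legendre's formula for progressions: an entry with multiplicity \<open>v\<close> is counted once for
  each of the powers \<open>p ^ 1, ..., p ^ v\<close>.
\<close>
lemma multiplicity_ap_prod:
  assumes "prime p" "b > 0" "\<And>j. j < m \<Longrightarrow> b + d * j < p ^ Suc T"
  shows "multiplicity p (ap_prod b d m) = (\<Sum>t\<in>{1..T}. ap_count b d m (p ^ t))"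
proof -
  have "multiplicity p (ap_prod b d m) = (\<Sum>j<m. multiplicity p (b + d * j))"
    unfolding ap_prod_def using assms
    by (intro prime_elem_multiplicity_prod_distrib) auto
  also have "\<dots> = (\<Sum>j<m. \<Sum>t\<in>{1..T}. if p ^ t dvd b + d * j then 1 else 0)"
  proof (rule sum.cong[OF refl])
    fix j assume j: "j \<in> {..<m}"
    let ?n = "b + d * j"
    have nz: "?n \<noteq> 0" "\<not> is_unit p" using assms by auto
    have "multiplicity p ?n \<le> T"
    proof (rule ccontr)
      assume "\<not> multiplicity p ?n \<le> T"
      hence "p ^ Suc T dvd ?n" using nz
        by (subst power_dvd_iff_le_multiplicity) auto
      hence "p ^ Suc T \<le> ?n" using nz by (intro dvd_imp_le) auto
      with assms(3)[of j] j show False by simp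
    qed
    hence "{t \<in> {1..T}. p ^ t dvd ?n} = {1..multiplicity p ?n}"
      using nz by (subst power_dvd_iff_le_multiplicity) auto
    hence "multiplicity p ?n = card {t \<in> {1..T}. p ^ t dvd ?n}" by simp
    also have "\<dots> = (\<Sum>t\<in>{1..T}. if p ^ t dvd ?n then 1 else 0)"
      by (simp add: sum.If_cases Int_def)
    finally show "multiplicity p ?n = (\<Sum>t\<in>{1..T}. if p ^ t dvd ?n then 1 else 0)" .
  qed
  also have "\<dots> = (\<Sum>t\<in>{1..T}. \<Sum>j<m. if p ^ t dvd b + d * j then 1 else 0)"
    by (rule sum.swap)
  also have "\<dots> = (\<Sum>t\<in>{1..T}. ap_count b d m (p ^ t))"
    by (intro sum.cong refl) (simp add: ap_count_def sum.If_cases Int_def)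
  finally show ?thesis .
qed

text \<open>
  The exponents \<open>t\<close> for which the progression starting at \<open>b\<close> has more multiples of
  \<open>p ^ t\<close> than the one starting at \<open>c\<close>. Both have length \<open>m\<close> and difference \<open>d\<close>, and \<open>N\<close>
  bounds their entries, so larger powers than \<open>N\<close> have no multiples at all.
\<close>
definition excess :: "nat \<Rightarrow> nat \<Rightarrow> nat \<Rightarrow> nat \<Rightarrow> nat \<Rightarrow> nat \<Rightarrow> nat set" where
  "excess b c d m N p =
     {t. 1 \<le> t \<and> p ^ t \<le> N \<and> ap_count c d m (p ^ t) < ap_count b d m (p ^ t)}"

lemma power_le_imp_exponent_less: "(p::nat) \<ge> 2 \<Longrightarrow> p ^ t \<le> N \<Longrightarrow> t < N"
  by (metis less_exp order_less_le_trans power_mono zero_le_numeral le_less_trans)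

lemma finite_excess:
  assumes "prime p"
  shows "finite (excess b c d m N p)"
proof -
  have "excess b c d m N p \<subseteq> {..<N}"
    using power_le_imp_exponent_less[of p] prime_ge_2_nat[OF assms] by (auto simp: excess_def)
  thus ?thesis using finite_subset by blast
qed

text \<open>
  By the two counting bounds the numbers of multiples of \<open>p ^ t\<close> in the two progressions
  differ by at most one, so each exponent of excess costs at most one factor \<open>p\<close>.
\<close>
lemma multiplicity_ap_prod_le:
  assumes "prime p" "coprime p d" "b > 0" "c > 0"
    and "\<And>j. j < m \<Longrightarrow> b + d * j \<le> N" "\<And>j. j < m \<Longrightarrow> c + d * j \<le> N" "N > 0"
  shows "multiplicity p (ap_prod b d m)
           \<le> multiplicity p (ap_prod c d m) + card (excess b c d m N p)"
proof -
  have p2: "p \<ge> 2" using assms prime_ge_2_nat by blast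
  have "\<exists>T. p ^ T \<le> N \<and> N < p ^ Suc T"
    using ex_power_ivl1[of p N] p2 assms(7) by auto
  then obtain T where T: "p ^ T \<le> N" "N < p ^ Suc T" by blast
  have "multiplicity p (ap_prod b d m) = (\<Sum>t\<in>{1..T}. ap_count b d m (p ^ t))"
    using assms T by (intro multiplicity_ap_prod) (auto intro: le_less_trans)
  also have "\<dots> \<le> (\<Sum>t\<in>{1..T}. ap_count c d m (p ^ t) +
                     (if t \<in> excess b c d m N p then 1 else 0))"
  proof (rule sum_mono)
    fix t assume t: "t \<in> {1..T}"
    have "p ^ t \<le> p ^ T" using t p2 by (intro power_increasing) auto
    hence ptN: "p ^ t \<le> N" using T by simp
    have cop: "coprime (p ^ t) d" "p ^ t > 0" using assms(2) p2 by auto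
    show "ap_count b d m (p ^ t) \<le> ap_count c d m (p ^ t) +
                     (if t \<in> excess b c d m N p then 1 else 0)"
      using ap_count_upper[OF cop, of b m] ap_count_lower[OF cop, of m c] t ptN
      by (auto simp: excess_def)
  qed
  also have "\<dots> = multiplicity p (ap_prod c d m) + card ({1..T} \<inter> excess b c d m N p)"
  proof -
    have "multiplicity p (ap_prod c d m) = (\<Sum>t\<in>{1..T}. ap_count c d m (p ^ t))"
      using assms T by (intro multiplicity_ap_prod) (auto intro: le_less_trans)
    thus ?thesis by (simp add: sum.distrib sum.If_cases)
  qed
  also have "card ({1..T} \<inter> excess b c d m N p) \<le> card (excess b c d m N p)"
    using assms by (intro card_mono finite_excess) auto
  finally show ?thesis by simp
qed

lemma ap_prod_pos: "b > 0 \<Longrightarrow> ap_prod b d m > 0"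
  by (simp add: ap_prod_def)

text \<open>
  If only primes from \<open>S\<close> occur in one product, its quotient by the other product is
  bounded by the prime powers that measure the excess. The quotient itself need not be an
  integer, hence the passage through prime factorizations.
\<close>
lemma ap_prod_le_excess:
  assumes "finite S" "\<And>p. p \<in> S \<Longrightarrow> prime p \<and> coprime p d"
    and "\<And>p. prime p \<Longrightarrow> p dvd ap_prod b d m \<Longrightarrow> p \<in> S"
    and "b > 0" "c > 0" "N > 0"
    and "\<And>j. j < m \<Longrightarrow> b + d * j \<le> N" "\<And>j. j < m \<Longrightarrow> c + d * j \<le> N"
  shows "ap_prod b d m \<le> ap_prod c d m * (\<Prod>p\<in>S. p ^ card (excess b c d m N p))"
proof -
  let ?P = "ap_prod b d m" and ?Q = "ap_prod c d m"
  have pos: "?P > 0" "?Q > 0" using assms ap_prod_pos by auto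
  have S: "prime_factors ?P \<subseteq> S" using assms(3) by auto
  have "?P = (\<Prod>p\<in>prime_factors ?P. p ^ multiplicity p ?P)"
    using pos by (simp add: prod_prime_factors)
  also have "\<dots> = (\<Prod>p\<in>S. p ^ multiplicity p ?P)"
    using S assms(1,2) pos
    by (intro prod.mono_neutral_left)
       (auto simp: prime_factors_multiplicity)
  also have "\<dots> dvd (\<Prod>p\<in>S. p ^ (multiplicity p ?Q + card (excess b c d m N p)))"
    using multiplicity_ap_prod_le assms by (intro prod_dvd_prod le_imp_power_dvd) blast
  also have "\<dots> = (\<Prod>p\<in>S. p ^ multiplicity p ?Q) * (\<Prod>p\<in>S. p ^ card (excess b c d m N p))"
    by (simp add: power_add prod.distrib)
  finally have 1: "?P dvd (\<Prod>p\<in>S. p ^ multiplicity p ?Q) * (\<Prod>p\<in>S. p ^ card (excess b c d m N p))" .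
  have "(\<Prod>p\<in>S. p ^ multiplicity p ?Q) dvd ?Q"
  proof (rule multiplicity_le_imp_dvd)
    show "(\<Prod>p\<in>S. p ^ multiplicity p ?Q) \<noteq> 0" using assms(1,2) by (auto dest: prime_gt_0_nat)
    fix p :: nat assume "prime p"
    thus "multiplicity p (\<Prod>p\<in>S. p ^ multiplicity p ?Q) \<le> multiplicity p ?Q"
      using assms(1,2) by (subst multiplicity_prod_prime_powers) auto
  qed
  hence 2: "?P dvd ?Q * (\<Prod>p\<in>S. p ^ card (excess b c d m N p))"
    using 1 by (meson dvd_trans mult_dvd_mono dvd_refl)
  have "(\<Prod>p\<in>S. p ^ card (excess b c d m N p)) > 0"
    using assms(1,2) by (auto intro!: prod_pos dest: prime_gt_0_nat)
  thus ?thesis using 2 pos by (intro dvd_imp_le) auto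
qed

text \<open>
  The number of exponents in a set of integers greater than \<open>k\<close> is at most its maximum
  minus \<open>k\<close>, and \<open>p\<close> to the maximum is at most \<open>N\<close>.
\<close>
lemma excess_subset_power_le:
  assumes "prime p" "N > 0" "excess b c d m N p \<subseteq> {k<..}"
  shows "p ^ card (excess b c d m N p) * p ^ k \<le> N \<or> excess b c d m N p = {}"
proof (cases "excess b c d m N p = {}")
  case False
  let ?E = "excess b c d m N p"
  have fin: "finite ?E" using assms finite_excess by blast
  have "?E \<subseteq> {k<..Max ?E}" using assms(3) fin by auto
  hence "card ?E \<le> card {k<..Max ?E}" by (intro card_mono) auto
  hence "card ?E + k \<le> Max ?E" using Max_in[OF fin False] assms(3) by auto
  hence "p ^ (card ?E + k) \<le> p ^ Max ?E"
    using prime_ge_2_nat[OF assms(1)] by (intro power_increasing) auto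
  also have "\<dots> \<le> N" using Max_in[OF fin False] by (auto simp: excess_def)
  finally show ?thesis by (simp add: power_add)
qed auto

lemma excess_power_le:
  assumes "prime p" "N > 0"
  shows "p ^ card (excess b c d m N p) \<le> N"
proof -
  have "excess b c d m N p \<subseteq> {0<..}" by (auto simp: excess_def)
  from excess_subset_power_le[OF assms this] show ?thesis using assms(2) by auto
qed

lemma excess_power_le_power:
  assumes "prime p" "N < p ^ Suc k"
  shows "p ^ card (excess b c d m N p) \<le> p ^ k"
proof -
  let ?E = "excess b c d m N p"
  have p: "p \<ge> 2" using assms prime_ge_2_nat by blast
  have "?E \<subseteq> {1..k}"
  proof
    fix t assume "t \<in> ?E"
    hence t: "1 \<le> t" "p ^ t \<le> N" by (auto simp: excess_def)
    hence "p ^ t < p ^ Suc k" using assms by simp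
    hence "t < Suc k" by (rule power_less_imp_less_exp[rotated]) (use p in simp)
    thus "t \<in> {1..k}" using t by simp
  qed
  hence "card ?E \<le> card {1..k}" by (intro card_mono) auto
  thus ?thesis using p by (intro power_increasing) auto
qed

section \<open>Products and numbers of primes\<close>

lemma prod_primes_dvd:
  fixes n :: nat
  assumes "finite S" "\<And>p. p \<in> S \<Longrightarrow> prime p \<and> p dvd n"
  shows "\<Prod>S dvd n"
  using assms
proof (induction S rule: finite_induct)
  case (insert p S)
  have "coprime p (\<Prod>S)"
    using insert.hyps insert.prems by (intro prod_coprime_right) (auto intro: primes_coprime)
  thus ?case using insert by (simp add: divides_mult)
qed simp

text \<open>
  Such primes divide \<open>fact n\<close> but neither of the factorials in the denominator of the
  binomial coefficient.
\<close>
lemma prod_primes_le_binomial: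
  assumes "k \<le> n" "\<And>p. p \<in> S \<Longrightarrow> prime p \<and> k < p \<and> n - k < p \<and> p \<le> n"
  shows "\<Prod>S \<le> n choose k"
proof -
  have fin: "finite S" using assms(2) by (intro finite_subset[of S "{..n}"]) auto
  have "p dvd n choose k" if "p \<in> S" for p
  proof -
    have p: "prime p" "k < p" "n - k < p" "p \<le> n" using assms(2)[OF that] by auto
    have "p dvd fact k * fact (n - k) * (n choose k)"
      using p assms(1) by (simp add: binomial_fact_lemma prime_dvd_fact_iff)
    thus ?thesis using p by (auto simp: prime_dvd_mult_iff prime_dvd_fact_iff)
  qed
  hence "\<Prod>S dvd n choose k" using assms(2) fin by (intro prod_primes_dvd) auto
  thus ?thesis using assms(1) by (intro dvd_imp_le) (auto simp: zero_less_binomial_iff)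
qed

lemma binomial_odd_central_le: "(2 * n + 1) choose n \<le> 4 ^ n"
proof -
  have "2 * ((2 * n + 1) choose n) = (\<Sum>k\<in>{n, n + 1}. (2 * n + 1) choose k)"
    using binomial_symmetric[of n "2 * n + 1"] by simp
  also have "\<dots> \<le> (\<Sum>k\<le>2 * n + 1. (2 * n + 1) choose k)"
    by (intro sum_mono2) auto
  also have "\<dots> = 2 ^ (2 * n + 1)" by (rule choose_row_sum)
  also have "\<dots> = 2 * 4 ^ n" by (simp add: power_mult)
  finally show ?thesis by simp
qed

lemma prod_primes_upper_half_le: "\<Prod>{p. prime p \<and> n < p \<and> p \<le> 2 * n} \<le> 4 ^ n"
proof -
  have "\<Prod>{p. prime p \<and> n < p \<and> p \<le> 2 * n} \<le> (2 * n) choose n"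
    by (intro prod_primes_le_binomial) auto
  also have "\<dots> \<le> 2 ^ (2 * n)" by (rule binomial_le_pow2)
  finally show ?thesis by (simp add: power_mult)
qed

text \<open>
  Chebyshev's estimate. The primes in the upper half of an interval divide a middle
  binomial coefficient, and the lower half is treated by induction.
\<close>
lemma primorial_le: "\<Prod>{p. prime p \<and> p \<le> n} \<le> (4::nat) ^ n"
proof (induction n rule: less_induct)
  case (less n)
  consider "n \<le> 1" | "n = 2" | "n > 2" "even n" | k where "n = 2 * k + 1" "k > 0"
  proof -
    have "n \<le> 1 \<or> n = 2 \<or> (n > 2 \<and> even n) \<or> (\<exists>k. n = 2 * k + 1 \<and> k > 0)"
      by presburger
    thus ?thesis using that by blast
  qed
  thus ?case
  proof cases
    case 1
    hence "{p. prime p \<and> p \<le> n} = {}" by (auto dest: prime_gt_1_nat)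
    thus ?thesis by (simp only:) simp
  next
    case 2
    have "prime p \<and> p \<le> 2 \<longleftrightarrow> p = 2" for p :: nat
      using prime_ge_2_nat[of p] by auto
    thus ?thesis using 2 by simp
  next
    case 3
    have "\<not> prime n" using 3 primes_dvd_imp_eq[of 2 n] by auto
    hence "{p. prime p \<and> p \<le> n} = {p. prime p \<and> p \<le> n - 1}"
      using 3 by (auto simp: le_less)
    hence "\<Prod>{p. prime p \<and> p \<le> n} \<le> 4 ^ (n - 1)" using less[of "n - 1"] 3 by simp
    also have "\<dots> \<le> 4 ^ n" by (intro power_increasing) auto
    finally show ?thesis .
  next
    \<comment> \<open>The primes above \<open>k + 1\<close> divide \<open>(2 * k + 1) choose k\<close>.\<close>
    case 4
    have split: "{p. prime p \<and> p \<le> n} =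
        {p. prime p \<and> p \<le> k + 1} \<union> {p. prime p \<and> k + 1 < p \<and> p \<le> 2 * k + 1}"
      using 4 by auto
    have "\<Prod>{p. prime p \<and> p \<le> n} =
        \<Prod>{p. prime p \<and> p \<le> k + 1} * \<Prod>{p. prime p \<and> k + 1 < p \<and> p \<le> 2 * k + 1}"
      unfolding split by (intro prod.union_disjoint) auto
    also have "\<dots> \<le> 4 ^ (k + 1) * ((2 * k + 1) choose k)"
      using 4 by (intro mult_le_mono less prod_primes_le_binomial) auto
    also have "\<dots> \<le> 4 ^ (k + 1) * 4 ^ k"
      by (intro mult_le_mono le_refl binomial_odd_central_le)
    also have "\<dots> = 4 ^ n" using 4 by (simp add: power_add mult_2)
    finally show ?thesis .
  qed
qed

text \<open>
  Primes other than \<open>2\<close> and \<open>3\<close> lie in the residue classes \<open>1\<close> and \<open>5\<close> modulo \<open>6\<close>, and the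
  map \<open>p \<mapsto> p div 3\<close> is injective on these classes. The composite number \<open>25\<close> occupies the
  value \<open>8\<close>, and this compensates for the prime \<open>3\<close>.
\<close>
lemma card_odd_primes_le:
  assumes "n \<ge> 24"
  shows "card {p. prime p \<and> 3 \<le> p \<and> p \<le> n} \<le> n div 3"
proof -
  let ?S = "{p. prime p \<and> 5 \<le> p \<and> p \<le> n}"
  have mods: "p mod 2 \<noteq> 0 \<and> p mod 3 \<noteq> 0" if "prime p" "5 \<le> p" for p :: nat
    using that primes_dvd_imp_eq[of 2 p] primes_dvd_imp_eq[of 3 p] two_is_prime_nat
    by (auto simp: mod_eq_0_iff_dvd simp del: even_iff_mod_2_eq_zero odd_iff_mod_2_eq_one
             simp flip: dvd_eq_mod_eq_0)
  have inj: "inj_on (\<lambda>p. p div 3) ?S"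
  proof (rule inj_onI)
    fix p q assume "p \<in> ?S" "q \<in> ?S" and eq: "p div 3 = q div 3"
    with mods[of p] mods[of q] have "p mod 3 \<noteq> 0" "q mod 3 \<noteq> 0" and odd: "odd p" "odd q" by auto
    hence "p mod 3 \<ge> 1" "p mod 3 \<le> 2" "q mod 3 \<ge> 1" "q mod 3 \<le> 2" by auto
    hence "p \<le> q + 1" "q \<le> p + 1"
      using eq div_mult_mod_eq[of p 3] div_mult_mod_eq[of q 3] by linarith+
    thus "p = q" using odd by presburger
  qed
  have sub: "(\<lambda>p. p div 3) ` ?S \<subseteq> {1..n div 3} - {8}"
  proof (rule image_subsetI)
    fix p assume p: "p \<in> ?S"
    have "p div 3 \<noteq> 8"
    proof
      assume "p div 3 = 8"
      hence "p = 24 \<or> p = 25 \<or> p = 26" by presburger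
      moreover have "\<not> prime (24::nat)" "\<not> prime (25::nat)" "\<not> prime (26::nat)" by simp_all
      ultimately show False using p by auto
    qed
    moreover have "p div 3 \<le> n div 3" using p by (auto intro: div_le_mono)
    moreover have "p div 3 \<ge> 1" using p by auto
    ultimately show "p div 3 \<in> {1..n div 3} - {8}" by auto
  qed
  have "card ?S \<le> card ({1..n div 3} - {8})"
    by (intro card_inj_on_le[OF inj sub]) auto
  also have "\<dots> = n div 3 - 1" using assms by (subst card_Diff_singleton) auto
  finally have S: "card ?S \<le> n div 3 - 1" .
  have "{p. prime p \<and> 3 \<le> p \<and> p \<le> n} \<subseteq> insert 3 ?S"
  proof
    fix p assume p: "p \<in> {p. prime p \<and> 3 \<le> p \<and> p \<le> n}"
    have "\<not> prime (4::nat)" by simp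
    hence "p \<noteq> 4" using p by auto
    thus "p \<in> insert 3 ?S" using p by auto
  qed
  hence "card {p. prime p \<and> 3 \<le> p \<and> p \<le> n} \<le> card (insert 3 ?S)"
    by (intro card_mono) auto
  also have "\<dots> = Suc (card ?S)" by (subst card_insert_disjoint) auto
  finally show ?thesis using S assms by linarith
qed

lemma card_primes_le: "card {p::nat. prime p \<and> p \<le> n} \<le> n div 2 + 1"
proof -
  have odd: "odd p" if "prime p" "p \<noteq> 2" for p :: nat
    using that primes_dvd_imp_eq[of 2 p] by auto
  \<comment> \<open>Halving is injective on odd numbers; the prime \<open>2\<close> accounts for the additional \<open>1\<close>.\<close>
  have inj: "inj_on (\<lambda>p. p div 2) {p. prime p \<and> p \<noteq> 2 \<and> p \<le> n}"
  proof (rule inj_onI)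
    fix p q :: nat assume "p \<in> {p. prime p \<and> p \<noteq> 2 \<and> p \<le> n}" "q \<in> {p. prime p \<and> p \<noteq> 2 \<and> p \<le> n}"
      and eq: "p div 2 = q div 2"
    hence "odd p" "odd q" using odd by auto
    thus "p = q" using eq by (metis odd_two_times_div_two_succ)
  qed
  have "card {p. prime p \<and> p \<noteq> 2 \<and> p \<le> n} \<le> card {1..n div 2}"
  proof (intro card_inj_on_le[OF inj] image_subsetI)
    fix p assume p: "p \<in> {p. prime p \<and> p \<noteq> 2 \<and> p \<le> n}"
    hence "p div 2 \<le> n div 2" by (intro div_le_mono) auto
    moreover have "p \<ge> 2" using p prime_ge_2_nat by auto
    ultimately show "p div 2 \<in> {1..n div 2}" by auto
  qed auto
  moreover have "card {p::nat. prime p \<and> p \<le> n} \<le> card (insert 2 {p. prime p \<and> p \<noteq> 2 \<and> p \<le> n})"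
    by (intro card_mono) auto
  ultimately show ?thesis
    by (simp add: card_insert_if split: if_splits)
qed

section \<open>Windows of odd numbers without large prime factors\<close>

lemma ap_prod_Suc: "ap_prod b d (Suc m) = ap_prod b d m * (b + d * m)"
  by (simp add: ap_prod_def)

lemma ap_prod_Suc_shift: "ap_prod b d (Suc m) = b * ap_prod (b + d) d m"
  unfolding ap_prod_def by (subst prod.lessThan_Suc_shift) (simp add: algebra_simps)

text \<open>
  The window that starts at \<open>2 * m + 1\<close>: its product divided by
  \<open>1 * 3 * ... * (2 * m - 1)\<close> grows by the factor
  \<open>(4 * m + 1) * (4 * m + 3) / (2 * m + 1)\<^sup>2\<close> from \<open>m\<close> to \<open>m + 1\<close>. This is slightly less
  than \<open>4\<close>, so the lower bound \<open>4 ^ m / 2\<close> is carried through the induction with the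
  additional factor \<open>1 + 1 / (4 * m)\<close>, which decreases fast enough to absorb the loss.
\<close>
lemma odd_central_ratio:
  "4 ^ m * (4 * m + 1) * ap_prod 1 2 m \<le> 8 * m * ap_prod (2 * m + 1) 2 m" if "m \<ge> 1"
  using that
proof (induction m rule: nat_induct_at_least)
  case base
  show ?case by (simp add: ap_prod_def)
next
  case (Suc m)
  let ?A = "ap_prod (2 * m + 1) 2 m" and ?Q = "ap_prod 1 2 m"
  let ?A' = "ap_prod (2 * Suc m + 1) 2 (Suc m)"
  have "(2 * m + 1) * ?A' = ap_prod (2 * m + 1) 2 (Suc (Suc m))"
    by (subst ap_prod_Suc_shift) simp
  also have "\<dots> = ?A * (4 * m + 1) * (4 * m + 3)"
    by (simp add: ap_prod_Suc algebra_simps)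
  finally have A': "(2 * m + 1) * ?A' = ?A * (4 * m + 1) * (4 * m + 3)" .
  have poly: "4 * m * (4 * m + 5) * (2 * m + 1) * (2 * m + 1)
               \<le> (4 * m + 1) * (4 * m + 1) * (4 * m + 3) * (m + 1)"
    by (simp add: algebra_simps)
  have "(m * (2 * m + 1)) * (4 ^ Suc m * (4 * Suc m + 1) * ap_prod 1 2 (Suc m))
        = 4 ^ m * ?Q * (4 * m * (4 * m + 5) * (2 * m + 1) * (2 * m + 1))"
    by (simp add: ap_prod_Suc algebra_simps)
  also have "\<dots> \<le> 4 ^ m * ?Q * ((4 * m + 1) * (4 * m + 1) * (4 * m + 3) * (m + 1))"
    by (intro mult_le_mono2 poly)
  also have "\<dots> = (4 ^ m * (4 * m + 1) * ?Q) * ((4 * m + 1) * (4 * m + 3) * (m + 1))"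
    by (simp only: mult_ac)
  also have "\<dots> \<le> (8 * m * ?A) * ((4 * m + 1) * (4 * m + 3) * (m + 1))"
    by (intro mult_le_mono1 Suc.IH)
  also have "\<dots> = 8 * m * (m + 1) * (?A * (4 * m + 1) * (4 * m + 3))"
    by (simp only: mult_ac)
  also have "\<dots> = (m * (2 * m + 1)) * (8 * Suc m * ?A')"
    unfolding A'[symmetric] by (simp only: mult_ac Suc_eq_plus1)
  finally show ?case using Suc.hyps by (subst (asm) mult_le_cancel1) simp
qed

text \<open>
  Moving the window from \<open>2 * m + 1\<close> to \<open>2 * a + 1\<close> multiplies the last entry \<open>4 * m - 1\<close>
  by \<open>(2 * a + 2 * m - 1) / (4 * m - 1)\<close> and each earlier entry by at least as much.
\<close>
lemma odd_ap_prod_lower: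
  assumes "m \<ge> 1" "a \<ge> m"
  shows "(2 * a + 2 * m - 1) ^ m * ap_prod 1 2 m \<le> 2 * m ^ m * ap_prod (2 * a + 1) 2 m"
proof -
  let ?N = "2 * a + 2 * m - 1" and ?Q = "ap_prod 1 2 m"
  let ?A = "ap_prod (2 * m + 1) 2 m" and ?P = "ap_prod (2 * a + 1) 2 m"
  have "8 * m * (4 ^ m * ?Q) \<le> 2 * (4 ^ m * (4 * m + 1) * ?Q)"
    by (simp add: algebra_simps)
  also have "\<dots> \<le> 2 * (8 * m * ?A)"
    by (intro mult_le_mono2 odd_central_ratio assms)
  finally have "8 * m * (4 ^ m * ?Q) \<le> 8 * m * (2 * ?A)" by (simp only: mult_ac)
  hence 1: "4 ^ m * ?Q \<le> 2 * ?A" using assms by (subst (asm) mult_le_cancel1) simp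
  have "?A * ?N ^ m = (\<Prod>j<m. (2 * m + 1 + 2 * j) * ?N)"
    unfolding ap_prod_def prod.distrib by (simp only: prod_constant card_lessThan)
  also have "\<dots> \<le> (\<Prod>j<m. (2 * a + 1 + 2 * j) * (4 * m - 1))"
  proof (intro prod_mono conjI)
    fix j assume j: "j \<in> {..<m}"
    obtain x where x: "a = m + x" using assms le_Suc_ex by blast
    obtain y where y: "m = j + 1 + y" using j by (metis Suc_eq_plus1 Suc_leI le_Suc_ex lessThan_iff)
    \<comment> \<open>In terms of the slacks \<open>x\<close> and \<open>y\<close> the two sides differ by \<open>4 * x * y\<close>.\<close>
    define u where "u = 2 * m + 1 + 2 * j"
    have "?N = u + 2 * x + 2 * y" "2 * a + 1 + 2 * j = u + 2 * x" "4 * m - 1 = u + 2 * y"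
      using x y by (simp_all add: u_def)
    moreover have "u * (u + 2 * x + 2 * y) \<le> (u + 2 * x) * (u + 2 * y)"
      by (simp add: algebra_simps)
    ultimately show "(2 * m + 1 + 2 * j) * ?N \<le> (2 * a + 1 + 2 * j) * (4 * m - 1)"
      by (simp only: u_def)
  qed auto
  also have "\<dots> = ?P * (4 * m - 1) ^ m"
    unfolding ap_prod_def prod.distrib by (simp only: prod_constant card_lessThan)
  finally have 2: "?A * ?N ^ m \<le> ?P * (4 * m - 1) ^ m" .
  have "4 ^ m * (?N ^ m * ?Q) = (4 ^ m * ?Q) * ?N ^ m" by (simp only: mult_ac)
  also have "\<dots> \<le> 2 * ?A * ?N ^ m" by (intro mult_le_mono1 1)
  also have "\<dots> = 2 * (?A * ?N ^ m)" by simp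
  also have "\<dots> \<le> 2 * (?P * (4 * m - 1) ^ m)" by (intro mult_le_mono2 2)
  also have "\<dots> \<le> 2 * (?P * (4 * m) ^ m)"
    by (intro mult_le_mono2 power_mono) auto
  also have "\<dots> = 4 ^ m * (2 * m ^ m * ?P)"
    by (simp add: power_mult_distrib)
  finally show ?thesis by simp
qed

definition odd_primes_upto :: "nat \<Rightarrow> nat set" where
  "odd_primes_upto n = {p. prime p \<and> 3 \<le> p \<and> p \<le> n}"

text \<open>
  The part of the product of the window \<open>2 * a + 1, ..., 2 * a + 2 * m - 1\<close> at the prime
  \<open>p\<close> that is not already accounted for by \<open>1 * 3 * ... * (2 * m - 1)\<close>.
\<close>
definition surplus :: "nat \<Rightarrow> nat \<Rightarrow> nat \<Rightarrow> nat" where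
  "surplus a m p = p ^ card (excess (2 * a + 1) 1 2 m (2 * a + 2 * m - 1) p)"

lemma finite_odd_primes_upto [simp]: "finite (odd_primes_upto n)"
  by (rule finite_subset[of _ "{..n}"]) (auto simp: odd_primes_upto_def)

lemma odd_prime_nat_iff: "prime (p::nat) \<Longrightarrow> odd p \<longleftrightarrow> 3 \<le> p"
  using prime_ge_2_nat[of p] primes_dvd_imp_eq[of 2 p] two_is_prime_nat
  by (cases "p = 2") auto

definition odd_window_smooth :: "nat \<Rightarrow> nat \<Rightarrow> bool" where
  "odd_window_smooth a m \<longleftrightarrow>
     (\<forall>p j. prime p \<longrightarrow> j < m \<longrightarrow> p dvd 2 * a + 1 + 2 * j \<longrightarrow> p \<le> 2 * m + 1)"

text \<open>
  The basic inequality for windows without large prime factors: the surplus has to make up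
  for the quotient of the two products.
\<close>
lemma odd_window_smooth_bound:
  assumes "m \<ge> 1" "a \<ge> m"
    and smooth: "odd_window_smooth a m"
  shows "(2 * a + 2 * m - 1) ^ m \<le> 2 * m ^ m * (\<Prod>p\<in>odd_primes_upto (2 * m + 1). surplus a m p)"
proof -
  let ?N = "2 * a + 2 * m - 1" and ?Q = "ap_prod 1 2 m" and ?P = "ap_prod (2 * a + 1) 2 m"
  let ?E = "\<Prod>p\<in>odd_primes_upto (2 * m + 1). surplus a m p"
  have "?P \<le> ?Q * (\<Prod>p\<in>odd_primes_upto (2 * m + 1).
                     p ^ card (excess (2 * a + 1) 1 2 m ?N p))"
  proof (rule ap_prod_le_excess)
    fix p assume "p \<in> odd_primes_upto (2 * m + 1)"
    thus "prime p \<and> coprime p 2"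
      by (auto simp: odd_primes_upto_def odd_prime_nat_iff)
  next
    fix p :: nat assume p: "prime p" "p dvd ?P"
    then obtain j where j: "j < m" "p dvd 2 * a + 1 + 2 * j"
      unfolding ap_prod_def by (auto simp: prime_dvd_prod_iff)
    have "odd (2 * a + 1 + 2 * j)" by simp
    hence "odd p" using j(2) dvd_trans by blast
    thus "p \<in> odd_primes_upto (2 * m + 1)"
      using p j smooth by (auto simp: odd_window_smooth_def odd_primes_upto_def odd_prime_nat_iff)
  qed (use assms in auto)
  hence PE: "?P \<le> ?Q * ?E" by (simp add: surplus_def)
  have "?Q * ?N ^ m \<le> 2 * m ^ m * ?P"
    using odd_ap_prod_lower[OF assms(1,2)] by (simp only: mult_ac)
  also have "\<dots> \<le> 2 * m ^ m * (?Q * ?E)" by (intro mult_le_mono2 PE)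
  also have "\<dots> = ?Q * (2 * m ^ m * ?E)" by (simp only: mult_ac)
  finally show ?thesis using ap_prod_pos[of 1 2 m] by simp
qed

lemma surplus_le:
  assumes "prime p" "m \<ge> 1"
  shows "surplus a m p \<le> 2 * a + 2 * m - 1"
  unfolding surplus_def using assms by (intro excess_power_le) auto

lemma surplus_le_power:
  assumes "prime p" "2 * a + 2 * m - 1 < p ^ Suc k"
  shows "surplus a m p \<le> p ^ k"
  unfolding surplus_def using assms by (intro excess_power_le_power)

lemma one_le_ap_count_odd:
  assumes "odd p" "p < 2 * m"
  shows "1 \<le> ap_count 1 2 m p"
proof -
  obtain j where j: "p = 2 * j + 1" using assms oddE by blast
  hence "{j} \<subseteq> {j. j < m \<and> p dvd 1 + 2 * j}" using assms by auto
  hence "card {j} \<le> ap_count 1 2 m p"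
    unfolding ap_count_def by (intro card_mono) auto
  thus ?thesis by simp
qed

lemma excess_gt_1: "1 \<notin> excess b c d m N p \<Longrightarrow> excess b c d m N p \<subseteq> {1<..}"
proof
  fix t assume "1 \<notin> excess b c d m N p" "t \<in> excess b c d m N p"
  moreover from this have "t \<noteq> 1" by metis
  ultimately show "t \<in> {1<..}" by (simp add: excess_def)
qed

text \<open>
  A prime between \<open>m\<close> and \<open>2 * m\<close> is one of the factors of \<open>1 * 3 * ... * (2 * m - 1)\<close>,
  and a window of \<open>m\<close> odd numbers is too short for two multiples of it.
\<close>
lemma excess_mid:
  assumes "prime p" "3 \<le> p" "m < p" "p < 2 * m"
  shows "excess b 1 2 m N p \<subseteq> {1<..}"
proof -
  have odd: "odd p" using assms odd_prime_nat_iff by blast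
  have "ap_count b 2 m p \<le> m div p + 1"
    using odd assms by (intro ap_count_upper) auto
  also have "\<dots> \<le> ap_count 1 2 m p"
    using one_le_ap_count_odd[OF odd assms(4)] assms(3) by simp
  finally have "1 \<notin> excess b 1 2 m N p" by (auto simp: excess_def)
  thus ?thesis by (rule excess_gt_1)
qed

text \<open>
  The window consists of odd numbers between \<open>2 * a\<close> and \<open>5 * p\<close>, where \<open>2 * a > p\<close>; the
  only odd multiple of \<open>p\<close> in that range is \<open>3 * p\<close>. The prime \<open>p\<close> itself is one of the
  factors of \<open>1 * 3 * ... * (2 * m - 1)\<close>.
\<close>
lemma excess_third:
  assumes "prime p" "3 \<le> p" "p \<le> m" "m \<le> a" "2 * a + 2 * m - 1 < 5 * p"
  shows "excess (2 * a + 1) 1 2 m N p \<subseteq> {1<..}"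
proof -
  have odd: "odd p" using assms odd_prime_nat_iff by blast
  have "{j. j < m \<and> p dvd (2 * a + 1) + 2 * j} \<subseteq> {(3 * p - (2 * a + 1)) div 2}"
  proof safe
    fix j assume j: "j < m" "p dvd (2 * a + 1) + 2 * j"
    then obtain k where k: "(2 * a + 1) + 2 * j = p * k" by blast
    have "odd (p * k)" unfolding k[symmetric] by simp
    hence "odd k" by simp
    have "p * k < p * 5" using k j(1) assms(5) by linarith
    hence "k < 5" by simp
    have "p * 1 < p * k" using k assms(3,4) by linarith
    hence "1 < k" by simp
    hence "k = 3" using \<open>k < 5\<close> \<open>odd k\<close> by presburger
    hence "3 * p - (2 * a + 1) = 2 * j" using k by simp
    thus "j = (3 * p - (2 * a + 1)) div 2" by simp
  qed
  hence "card {j. j < m \<and> p dvd (2 * a + 1) + 2 * j} \<le> card {(3 * p - (2 * a + 1)) div 2}"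
    by (intro card_mono) auto
  hence "ap_count (2 * a + 1) 2 m p \<le> 1" by (simp add: ap_count_def)
  also have "\<dots> \<le> ap_count 1 2 m p"
    using odd assms by (intro one_le_ap_count_odd) auto
  finally have "1 \<notin> excess (2 * a + 1) 1 2 m N p" by (auto simp: excess_def)
  thus ?thesis by (rule excess_gt_1)
qed

text \<open>
  The first power has no excess, and the second one exceeds all entries.
\<close>
lemma surplus_eq_1:
  assumes "prime p" "3 \<le> p" "m \<le> a" "2 * a + 2 * m - 1 < p\<^sup>2"
    and "m < p \<and> p < 2 * m \<or> p \<le> m \<and> 2 * a + 2 * m - 1 < 5 * p"
  shows "surplus a m p = 1"
proof -
  let ?E = "excess (2 * a + 1) 1 2 m (2 * a + 2 * m - 1) p"
  have "?E \<subseteq> {1<..}"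
    using assms excess_mid[of p m] excess_third[of p m a] by blast
  moreover have "t < 2" if "t \<in> ?E" for t
  proof -
    have "p ^ t \<le> 2 * a + 2 * m - 1" using that by (simp add: excess_def)
    hence "p ^ t < p ^ 2" using assms(4) by linarith
    thus ?thesis by (rule power_less_imp_less_exp[rotated]) (use assms in simp)
  qed
  ultimately have "?E = {}" by force
  thus ?thesis by (simp add: surplus_def)
qed

lemma surplus_mult_le:
  assumes "prime p" "3 \<le> p" "m \<le> a" "m < p" "p < 2 * m"
  shows "surplus a m p * p \<le> 2 * a + 2 * m - 1"
proof -
  have "excess (2 * a + 1) 1 2 m (2 * a + 2 * m - 1) p \<subseteq> {1<..}"
    using assms by (intro excess_mid) auto
  from excess_subset_power_le[OF assms(1) _ this] assms show ?thesis
    by (auto simp: surplus_def)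
qed

section \<open>Size bounds for smooth windows\<close>

text \<open>
  The cube of the assumption has \<open>N ^ (3 * m)\<close> on the left and at most \<open>N ^ m\<close> on the
  right; the \<open>m\<close>-th root of the rest is the claim.
\<close>
lemma square_le_of_power_le:
  fixes N m k b c d :: nat
  assumes "N ^ m \<le> c * b ^ m * N ^ k" "3 * k \<le> m" "c ^ 3 \<le> d ^ m" "N > 0" "m > 0"
  shows "N\<^sup>2 \<le> d * b ^ 3"
proof -
  have "(N\<^sup>2) ^ m * N ^ m = (N ^ m) ^ 3"
    by (simp add: power_mult[symmetric] power_add[symmetric] algebra_simps)
  also have "\<dots> \<le> (c * b ^ m * N ^ k) ^ 3"
    by (intro power_mono assms) auto
  also have "\<dots> = c ^ 3 * (b ^ 3) ^ m * N ^ (3 * k)"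
    by (simp add: power_mult_distrib power_mult[symmetric] mult.commute)
  also have "\<dots> \<le> d ^ m * (b ^ 3) ^ m * N ^ m"
    using assms(2,4) by (intro mult_le_mono assms(3) le_refl power_increasing) auto
  also have "\<dots> = (d * b ^ 3) ^ m * N ^ m"
    by (simp only: power_mult_distrib)
  finally have "(N\<^sup>2) ^ m \<le> (d * b ^ 3) ^ m"
    by (rule mult_right_le_imp_le) (use assms(4) in simp)
  thus ?thesis using assms(5) by (simp only: power_mono_iff)
qed

definition middle_primes :: "nat \<Rightarrow> nat set" where
  "middle_primes m = {p. prime p \<and> m < p \<and> p < 2 * m}"

lemma finite_middle_primes [simp]: "finite (middle_primes m)"
  by (rule finite_subset[of _ "{..2 * m}"]) (auto simp: middle_primes_def)

lemma odd_primes_upto_double: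
  assumes "m \<ge> 2"
  shows "odd_primes_upto (2 * m + 1) =
           odd_primes_upto m \<union> middle_primes m \<union> {p. prime p \<and> p = 2 * m + 1}"
proof -
  have "\<not> prime (2 * m)" using assms primes_dvd_imp_eq[of 2 "2 * m"] by auto
  hence "p \<noteq> 2 * m" if "prime p" for p using that by auto
  moreover have "p \<le> 2 * m + 1 \<longleftrightarrow> p \<le> m \<or> (m < p \<and> p < 2 * m) \<or> p = 2 * m \<or> p = 2 * m + 1" for p
    using assms by arith
  ultimately show ?thesis
    using assms by (auto simp: odd_primes_upto_def middle_primes_def)
qed

lemma prod_odd_primes_upto_double:
  fixes f :: "nat \<Rightarrow> nat"
  assumes "m \<ge> 2"
  shows "(\<Prod>p\<in>odd_primes_upto (2 * m + 1). f p) =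
           (\<Prod>p\<in>odd_primes_upto m. f p) * (\<Prod>p\<in>middle_primes m. f p) *
           (if prime (2 * m + 1) then f (2 * m + 1) else 1)"
proof -
  have "finite {p. prime p \<and> p = 2 * m + 1}" by simp
  moreover have "{p. prime p \<and> p = 2 * m + 1} = (if prime (2 * m + 1) then {2 * m + 1} else {})"
    by auto
  moreover have "odd_primes_upto m \<inter> middle_primes m = {}"
    "(odd_primes_upto m \<union> middle_primes m) \<inter> {p. prime p \<and> p = 2 * m + 1} = {}"
    by (auto simp: odd_primes_upto_def middle_primes_def)
  ultimately show ?thesis
    unfolding odd_primes_upto_double[OF assms]
    by (simp add: prod.union_disjoint)
qed

text \<open>
  The three ranges of primes are estimated separately: up to \<open>m\<close>, strictly between \<open>m\<close> and
  \<open>2 * m\<close>, and the single candidate \<open>2 * m + 1\<close>.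
\<close>
lemma prod_odd_primes_upto_double_le:
  fixes f :: "nat \<Rightarrow> nat"
  assumes "m \<ge> 2" "(\<Prod>p\<in>odd_primes_upto m. f p) \<le> x" "(\<Prod>p\<in>middle_primes m. f p) \<le> y"
    and "(if prime (2 * m + 1) then f (2 * m + 1) else 1) \<le> z"
  shows "(\<Prod>p\<in>odd_primes_upto (2 * m + 1). f p) \<le> x * y * z"
  unfolding prod_odd_primes_upto_double[OF assms(1)] by (intro mult_le_mono assms)

lemma prod_surplus_small_le:
  assumes "m \<ge> 24"
  shows "(\<Prod>p\<in>odd_primes_upto m. surplus a m p) \<le> (2 * a + 2 * m - 1) ^ (m div 3)"
proof -
  have "(\<Prod>p\<in>odd_primes_upto m. surplus a m p) \<le> (\<Prod>p\<in>odd_primes_upto m. 2 * a + 2 * m - 1)"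
  proof (intro prod_mono conjI)
    fix p assume "p \<in> odd_primes_upto m"
    hence "prime p" by (simp add: odd_primes_upto_def)
    thus "surplus a m p \<le> 2 * a + 2 * m - 1" using assms by (intro surplus_le) auto
  qed auto
  also have "\<dots> = (2 * a + 2 * m - 1) ^ card (odd_primes_upto m)" by simp
  also have "\<dots> \<le> (2 * a + 2 * m - 1) ^ (m div 3)"
    using assms by (intro power_increasing card_odd_primes_le[folded odd_primes_upto_def]) auto
  finally show ?thesis .
qed

text \<open>
  In the middle range only squares can have an excess when all entries are below \<open>p ^ 3\<close>,
  so each surplus is at most \<open>p\<close>. The product of these primes is at most the middle
  binomial coefficient.
\<close>
lemma prod_surplus_middle_le:
  assumes "m \<ge> 2" "m \<le> a" "2 * a + 2 * m - 1 < (m + 1) ^ 3"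
  shows "(\<Prod>p\<in>middle_primes m. surplus a m p) \<le> 4 ^ m"
proof -
  have "(\<Prod>p\<in>middle_primes m. surplus a m p) \<le> (\<Prod>p\<in>middle_primes m. p)"
  proof (intro prod_mono conjI)
    fix p assume "p \<in> middle_primes m"
    hence p: "prime p" "m < p" "p < 2 * m" by (auto simp: middle_primes_def)
    have "p ^ (Suc (card (excess (2 * a + 1) 1 2 m (2 * a + 2 * m - 1) p))) \<le> 2 * a + 2 * m - 1"
      using surplus_mult_le[of p m a] p assms by (simp add: surplus_def mult.commute)
    also have "\<dots> < (m + 1) ^ 3" by (rule assms)
    also have "\<dots> \<le> p ^ 3" using p by (intro power_mono) auto
    finally have "Suc (card (excess (2 * a + 1) 1 2 m (2 * a + 2 * m - 1) p)) < 3"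
      by (rule power_less_imp_less_exp[rotated]) (use p assms in simp)
    hence "surplus a m p \<le> p ^ 1"
      unfolding surplus_def using p by (intro power_increasing) auto
    thus "surplus a m p \<le> p" by simp
  qed auto
  also have "\<dots> \<le> \<Prod>{p. prime p \<and> m < p \<and> p \<le> 2 * m}"
    by (intro dvd_imp_le prod_dvd_prod_subset prod_pos)
       (auto simp: middle_primes_def dest: prime_gt_0_nat)
  also have "\<dots> \<le> 4 ^ m" by (rule prod_primes_upper_half_le)
  finally show ?thesis .
qed

lemma prod_surplus_middle_eq_1:
  assumes "m \<ge> 2" "m \<le> a" "2 * a + 2 * m - 1 < (m + 1)\<^sup>2"
  shows "(\<Prod>p\<in>middle_primes m. surplus a m p) = 1"
proof (rule prod.neutral, safe)
  fix p assume "p \<in> middle_primes m"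
  hence p: "prime p" "m < p" "p < 2 * m" by (auto simp: middle_primes_def)
  have "(m + 1)\<^sup>2 \<le> p\<^sup>2" using p by (intro power_mono) auto
  hence "2 * a + 2 * m - 1 < p\<^sup>2" using assms(3) by (rule order_less_le_trans[rotated])
  thus "surplus a m p = 1" using p assms(1,2) by (intro surplus_eq_1) auto
qed

lemma surplus_if_prime_le:
  assumes "2 * a + 2 * m - 1 < p ^ Suc k" "p > 0"
  shows "(if prime p then surplus a m p else 1) \<le> p ^ k"
  using surplus_le_power[OF _ assms(1)] assms(2) by simp

lemma growth_cubic_aux:
  assumes "49 * u \<le> 51 * (v::nat)"
  shows "u ^ 3 \<le> 2 * v ^ 3"
proof -
  have "49 ^ 3 * u ^ 3 = (49 * u) ^ 3" by (simp only: power_mult_distrib)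
  also have "\<dots> \<le> (51 * v) ^ 3" using assms by (intro power_mono) auto
  also have "\<dots> = 51 ^ 3 * v ^ 3" by (simp only: power_mult_distrib)
  also have "\<dots> \<le> 49 ^ 3 * (2 * v ^ 3)" by simp
  finally show ?thesis by simp
qed

lemma growth_cubic: "m \<ge> 24 \<Longrightarrow> (2 * (2 * m + 1)) ^ 3 \<le> (2::nat) ^ m"
proof (induction m rule: nat_induct_at_least)
  case (Suc m)
  have "(2 * (2 * Suc m + 1)) ^ 3 \<le> 2 * (2 * (2 * m + 1)) ^ 3"
    using Suc.hyps by (intro growth_cubic_aux) simp
  also have "\<dots> \<le> 2 ^ Suc m" using Suc.IH by simp
  finally show ?case .
qed simp

text \<open>
  Passing from \<open>m\<close> to \<open>m + 1\<close> multiplies \<open>2 * m + 1\<close> by at most \<open>51 / 49\<close> when \<open>m \<ge> 24\<close>,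
  and the sixth power of this number is less than \<open>3\<close>.
\<close>
lemma growth_sextic: "m \<ge> 24 \<Longrightarrow> (2 * (2 * m + 1)\<^sup>2) ^ 3 \<le> (3::nat) ^ m"
proof (induction m rule: nat_induct_at_least)
  case (Suc m)
  define u v where "u = 2 * Suc m + 1" and "v = 2 * m + 1"
  have "49 * u \<le> 51 * v" using Suc.hyps by (simp add: u_def v_def)
  have "49 ^ 6 * (2 * u\<^sup>2) ^ 3 = 8 * (49 * u) ^ 6"
    by (simp add: power_mult_distrib power_mult[symmetric])
  also have "\<dots> \<le> 8 * (51 * v) ^ 6"
    using \<open>49 * u \<le> 51 * v\<close> by (intro mult_le_mono2 power_mono) auto
  also have "\<dots> = 51 ^ 6 * (2 * v\<^sup>2) ^ 3"
    by (simp add: power_mult_distrib power_mult[symmetric])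
  also have "\<dots> \<le> (49 ^ 6 * 3) * (2 * v\<^sup>2) ^ 3"
    by (intro mult_le_mono1) simp
  also have "\<dots> \<le> (49 ^ 6 * 3) * 3 ^ m"
    using Suc.IH unfolding v_def by (intro mult_le_mono2)
  also have "\<dots> = 49 ^ 6 * 3 ^ Suc m" by simp
  finally have "(2 * u\<^sup>2) ^ 3 \<le> 3 ^ Suc m" by (rule mult_left_le_imp_le) simp
  thus ?case unfolding u_def .
qed simp

text \<open>
  There are at most \<open>m / 3\<close> odd primes up to \<open>m\<close>, each with surplus at most \<open>N\<close>; the
  middle primes contribute at most \<open>4 ^ m\<close> and \<open>2 * m + 1\<close> at most its square. So \<open>N ^ m\<close>
  is at most \<open>2 * (2 * m + 1)\<^sup>2 * (4 * m) ^ m * N ^ (m / 3)\<close>, and the polynomial factor is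
  swallowed by \<open>3 ^ (m / 3)\<close>.
\<close>
lemma smooth_window_medium:
  fixes a m :: nat
  assumes "m \<ge> 24" "a > m" "2 * a + 2 * m - 1 \<le> 12 * m\<^sup>2 + 8 * m"
    and smooth: "odd_window_smooth a m"
  shows "(2 * a + 2 * m - 1)\<^sup>2 \<le> 192 * m ^ 3"
proof -
  let ?N = "2 * a + 2 * m - 1"
  have "12 * m\<^sup>2 + 8 * m < 13 * m\<^sup>2" using assms(1) by (simp add: power2_eq_square)
  also have "\<dots> \<le> m * m\<^sup>2" using assms(1) by simp
  finally have N3: "?N < m ^ 3" using assms(3) by (simp add: power3_eq_cube power2_eq_square)
  also have "\<dots> \<le> (m + 1) ^ 3" by (intro power_mono) auto
  finally have mid: "(\<Prod>p\<in>middle_primes m. surplus a m p) \<le> 4 ^ m"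
    using assms(1,2) by (intro prod_surplus_middle_le) auto
  have "m ^ 3 \<le> (2 * m + 1) ^ 3" by (intro power_mono) auto
  hence top: "(if prime (2 * m + 1) then surplus a m (2 * m + 1) else 1) \<le> (2 * m + 1)\<^sup>2"
    using N3 by (intro surplus_if_prime_le) (simp_all add: eval_nat_numeral)
  have "?N ^ m \<le> 2 * m ^ m * (\<Prod>p\<in>odd_primes_upto (2 * m + 1). surplus a m p)"
    using assms by (intro odd_window_smooth_bound) auto
  also have "(\<Prod>p\<in>odd_primes_upto (2 * m + 1). surplus a m p)
      \<le> ?N ^ (m div 3) * 4 ^ m * (2 * m + 1)\<^sup>2"
    using assms(1) top mid by (intro prod_odd_primes_upto_double_le prod_surplus_small_le) auto
  finally have "?N ^ m \<le> 2 * m ^ m * (?N ^ (m div 3) * 4 ^ m * (2 * m + 1)\<^sup>2)" by simp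
  also have "2 * m ^ m * (?N ^ (m div 3) * 4 ^ m * (2 * m + 1)\<^sup>2)
      = 2 * (2 * m + 1)\<^sup>2 * (4 * m) ^ m * ?N ^ (m div 3)"
    by (simp only: power_mult_distrib mult_ac)
  finally have "?N ^ m \<le> 2 * (2 * m + 1)\<^sup>2 * (4 * m) ^ m * ?N ^ (m div 3)" by simp
  hence "?N\<^sup>2 \<le> 3 * (4 * m) ^ 3"
    using assms growth_sextic[OF assms(1)] by (intro square_le_of_power_le) auto
  thus ?thesis by (simp add: power_mult_distrib)
qed

text \<open>
  Here the weaker bound already gives \<open>N \<le> m\<^sup>2\<close>, so the squares of the middle primes
  exceed all entries and the factor \<open>4 ^ m\<close> disappears.
\<close>
lemma smooth_window_large:
  fixes a m :: nat
  assumes "m \<ge> 192" "a > m" "2 * a + 2 * m - 1 \<le> 12 * m\<^sup>2 + 8 * m"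
    and smooth: "odd_window_smooth a m"
  shows "(2 * a + 2 * m - 1)\<^sup>2 \<le> 2 * m ^ 3"
proof -
  let ?N = "2 * a + 2 * m - 1"
  have "?N\<^sup>2 \<le> 192 * m ^ 3" using assms by (intro smooth_window_medium) auto
  also have "\<dots> \<le> m * m ^ 3" using assms(1) by simp
  also have "\<dots> = (m\<^sup>2)\<^sup>2" by (simp add: power2_eq_square power3_eq_cube)
  finally have "?N \<le> m\<^sup>2" by (simp only: power2_nat_le_eq_le)
  hence N2: "?N < (m + 1)\<^sup>2" by (simp add: power2_eq_square)
  hence mid: "(\<Prod>p\<in>middle_primes m. surplus a m p) = 1"
    using assms by (intro prod_surplus_middle_eq_1) auto
  have "(m + 1)\<^sup>2 \<le> (2 * m + 1)\<^sup>2" by (intro power_mono) auto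
  hence top: "(if prime (2 * m + 1) then surplus a m (2 * m + 1) else 1) \<le> 2 * m + 1"
    using N2 surplus_if_prime_le[of a m "2 * m + 1" 1] by (simp add: eval_nat_numeral)
  have "?N ^ m \<le> 2 * m ^ m * (\<Prod>p\<in>odd_primes_upto (2 * m + 1). surplus a m p)"
    using assms by (intro odd_window_smooth_bound) auto
  also have "(\<Prod>p\<in>odd_primes_upto (2 * m + 1). surplus a m p) \<le> ?N ^ (m div 3) * 1 * (2 * m + 1)"
    using assms(1) top mid by (intro prod_odd_primes_upto_double_le prod_surplus_small_le) auto
  finally have "?N ^ m \<le> 2 * m ^ m * (?N ^ (m div 3) * 1 * (2 * m + 1))" by simp
  also have "2 * m ^ m * (?N ^ (m div 3) * 1 * (2 * m + 1))
      = 2 * (2 * m + 1) * m ^ m * ?N ^ (m div 3)"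
    by (simp only: mult_ac mult_1)
  finally have "?N ^ m \<le> 2 * (2 * m + 1) * m ^ m * ?N ^ (m div 3)" by simp
  thus "?N\<^sup>2 \<le> 2 * m ^ 3"
    using assms growth_cubic[of m] by (intro square_le_of_power_le) auto
qed

section \<open>No smooth window for large lengths\<close>

lemma exp_4_ge: "exp (4::real) \<ge> 50"
proof -
  have "(33/32::real) \<le> exp (1/32)" using exp_ge_add_one_self[of "1/32::real"] by simp
  hence "(33/32::real) ^ 128 \<le> exp (1/32) ^ 128" by (intro power_mono) auto
  also have "\<dots> = exp 4" by (simp add: exp_of_nat_mult[symmetric])
  finally show ?thesis by (rule order_trans[rotated]) (simp add: power_divide)
qed

lemma exp_1_ge: "exp (1::real) \<ge> 5 / 2"
proof -
  have "(9/8::real) \<le> exp (1/8)" using exp_ge_add_one_self[of "1/8::real"] by simp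
  hence "(9/8::real) ^ 8 \<le> exp (1/8) ^ 8" by (intro power_mono) auto
  also have "\<dots> = exp 1" by (simp add: exp_of_nat_mult[symmetric])
  finally show ?thesis by (rule order_trans[rotated]) (simp add: power_divide)
qed

text \<open>
  The logarithm lies below its tangent at \<open>exp c\<close>.
\<close>
lemma ln_le_tangent:
  assumes "x > 0" shows "ln x \<le> x / exp c + (c - 1 :: real)"
proof -
  have "ln (x / exp c) \<le> x / exp c - 1" using assms by (intro ln_le_minus_one) simp
  thus ?thesis using assms by (simp add: ln_div)
qed

lemma ln_ge_one_minus_inverse:
  assumes "x > 0" shows "1 - 1 / x \<le> ln (x::real)"
  using ln_le_minus_one[of "1 / x"] assms by (simp add: ln_div)

lemma size_contradiction_near:
  fixes x y :: real
  assumes "4 \<le> x" "y \<ge> 90"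
  shows "(3 + 2 / 3 * y) * ln y < 1 / 25 * y\<^sup>2"
proof -
  have "ln y \<le> y / exp 4 + 3" using ln_le_tangent[of y 4] assms by simp
  also have "\<dots> \<le> y / 50 + 3"
    using exp_4_ge assms by (intro add_right_mono divide_left_mono) auto
  finally have "(3 + 2 / 3 * y) * ln y \<le> (3 + 2 / 3 * y) * (y / 50 + 3)"
    using assms by (intro mult_left_mono) auto
  \<comment> \<open>Arranged around \<open>y - 90\<close>, the subtracted polynomial is visibly positive.\<close>
  also have "\<dots> = 1 / 25 * y\<^sup>2 - (2 / 75 * (y - 90) * y + 17 / 50 * (y - 90) + 108 / 5)"
    by (simp add: field_simps power2_eq_square)
  finally have "(3 + 2 / 3 * y) * ln y
      \<le> 1 / 25 * y\<^sup>2 - (2 / 75 * (y - 90) * y + 17 / 50 * (y - 90) + 108 / 5)" .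
  moreover have "0 \<le> 2 / 75 * (y - 90) * y" "0 \<le> 17 / 50 * (y - 90)" using assms by auto
  ultimately show ?thesis by linarith
qed

lemma size_contradiction_far:
  fixes w y :: real
  assumes "y \<le> 2 * w ^ 3" "w \<ge> 23 / 5" "y \<ge> 200"
  shows "(3 + 2 / 3 * y) * ln y < y * w"
proof -
  have "ln y \<le> ln (2 * w ^ 3)" using assms by simp
  also have "\<dots> = ln 2 + 3 * ln w" using assms by (simp add: ln_mult ln_realpow)
  also have "ln w \<le> w / exp 1" using ln_le_tangent[of w 1] assms by simp
  also have "w / exp 1 \<le> w / (5 / 2)"
    using exp_1_ge assms by (intro divide_left_mono) auto
  also have "ln (2::real) \<le> 1" using ln_2_less_1 by simp
  finally have ln: "ln y \<le> 1 + 6 / 5 * w" by simp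
  have "(3 + 2 / 3 * y) * ln y \<le> (3 + 2 / 3 * y) * (1 + 6 / 5 * w)"
    using assms by (intro mult_left_mono ln) auto
  \<comment> \<open>The constants satisfy \<open>3 \<le> 3 / 200 * y\<close> and \<open>1 \<le> 5 / 23 * w\<close>; their product is below \<open>1\<close>.\<close>
  also have "\<dots> \<le> (341 / 500 * y) * (71 / 50 * w)"
    using assms by (intro mult_mono) auto
  also have "\<dots> < y * w" using assms by simp
  finally show ?thesis .
qed

text \<open>
  Write \<open>N = x * M\<close> and \<open>y = sqrt N\<close>. After subtracting the term with \<open>ln 4\<close> the
  right-hand side is at least \<open>M * x / 25 = y\<^sup>2 / 25\<close> for \<open>4 \<le> x \<le> 20\<close>. This follows from
  \<open>ln z \<ge> 1 - 1 / z\<close>; the critical values are \<open>x = 4\<close> and \<open>x = 5\<close>, where only \<open>M / 5\<close> is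
  left. For \<open>x > 20\<close> it is at least \<open>M = y * (y / x)\<close>, and the hypothesis
  \<open>N\<^sup>2 \<le> 2 * M ^ 3\<close> makes \<open>y / x\<close> at least the cube root of \<open>y / 2\<close>. In both ranges this
  beats the remaining terms, which are of the order \<open>y * ln y\<close>.
\<close>
lemma size_contradiction:
  fixes M N :: real
  assumes "M \<ge> 2048" "N \<ge> 4 * M" "N\<^sup>2 \<le> 2 * M ^ 3"
  shows "ln (4 * M + 2) + sqrt N / 3 * ln N + min M (N / 5) * ln 4 < M * ln (N / M)"
proof -
  define x y where "x = N / M" and "y = sqrt N"
  have pos: "M > 0" "N > 0" using assms by auto
  have y2: "y\<^sup>2 = N" using pos by (simp add: y_def)
  have x: "x \<ge> 4" "N = x * M" using assms pos by (auto simp: x_def field_simps)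
  have y: "y > 0" using pos by (simp add: y_def)
  have "90\<^sup>2 \<le> y\<^sup>2" using y2 assms by simp
  hence y90: "90 \<le> y" by (rule power2_le_imp_le) (use y in simp)
  have lnN: "ln N = 2 * ln y" using y y2 by (simp add: ln_realpow flip: y2)
  have "4 * M + 2 \<le> 2 * y\<^sup>2" using y2 assms by simp
  also have "\<dots> \<le> y * y\<^sup>2" using y90 by (intro mult_right_mono) auto
  finally have "ln (4 * M + 2) \<le> ln (y ^ 3)"
    using pos y by (simp add: power3_eq_cube power2_eq_square)
  hence "ln (4 * M + 2) \<le> 3 * ln y" using y by (simp add: ln_realpow)
  hence main: "ln (4 * M + 2) + sqrt N / 3 * ln N \<le> (3 + 2 / 3 * y) * ln y"
    by (simp add: lnN y_def algebra_simps)
  have ln4: "ln (4::real) \<ge> 1"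
    using exp_le by (subst ln_ge_iff) auto
  have lnx4: "ln x = ln (x / 4) + ln 4" using x by (simp add: ln_div)
  have gain: "1 - 4 / x \<le> ln (x / 4)" using ln_ge_one_minus_inverse[of "x / 4"] x by simp
  show ?thesis
  proof (cases "x \<le> 20")
    case True
    have "M * (1 / 25 * x) \<le> M * ln x - min M (N / 5) * ln 4"
    proof (cases "x \<le> 5")
      case x5: True
      have "(x - 4) * (x - 5) \<le> 0" using x x5 by (intro mult_nonneg_nonpos) auto
      hence "x * x + 20 \<le> 9 * x" by (simp add: algebra_simps)
      hence "x / 5 + 4 / x \<le> 9 / 5" using x by (simp add: field_simps)
      moreover have "(1 - x / 5) * 1 \<le> (1 - x / 5) * ln 4" using x5 ln4 by (intro mult_left_mono) auto
      ultimately have "1 / 5 \<le> ln x - x / 5 * ln 4"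
        using gain lnx4 by (simp add: algebra_simps)
      moreover have "1 / 25 * x \<le> 1 / 5" using x5 by simp
      ultimately have "M * (1 / 25 * x) \<le> M * (ln x - x / 5 * ln 4)"
        using pos by (intro mult_left_mono) auto
      also have "\<dots> = M * ln x - N / 5 * ln 4" using x by (simp add: algebra_simps)
      also have "\<dots> \<le> M * ln x - min M (N / 5) * ln 4"
        using ln4 by (intro diff_left_mono mult_right_mono) auto
      finally show ?thesis .
    next
      case x5: False
      have "(x - 5) * (x - 20) \<le> 0" using x5 True by (intro mult_nonneg_nonpos) auto
      hence "x * x + 100 \<le> 25 * x" by (simp add: algebra_simps)
      hence "1 / 25 * x \<le> 1 - 4 / x" using x by (simp add: field_simps)
      hence "1 / 25 * x \<le> ln (x / 4)" using gain by simp
      hence "M * (1 / 25 * x) \<le> M * ln (x / 4)" using pos by (intro mult_left_mono) auto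
      also have "\<dots> = M * ln x - M * ln 4" by (simp add: lnx4 algebra_simps)
      also have "\<dots> \<le> M * ln x - min M (N / 5) * ln 4"
        using ln4 by (intro diff_left_mono mult_right_mono) auto
      finally show ?thesis .
    qed
    moreover have "M * (1 / 25 * x) = 1 / 25 * y\<^sup>2" using x y2 by simp
    ultimately show ?thesis
      using main size_contradiction_near[OF x(1) y90] by (simp add: x_def)
  next
    case False
    define w where "w = y / x"
    have M: "M = y * w" using x y2 pos by (simp add: w_def field_simps power2_eq_square)
    have "1 \<le> ln (x / 4)"
      using exp_le False by (subst ln_ge_iff) auto
    hence "M * 1 \<le> M * ln (x / 4)" using pos by (intro mult_left_mono) auto
    also have "\<dots> = M * ln x - M * ln 4" by (simp add: lnx4 algebra_simps)
    also have "\<dots> \<le> M * ln x - min M (N / 5) * ln 4"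
      using ln4 by (intro diff_left_mono mult_right_mono) auto
    finally have g: "y * w \<le> M * ln x - min M (N / 5) * ln 4" using M by simp
    have "200\<^sup>2 \<le> y\<^sup>2"
    proof -
      have "20 * 2048 \<le> x * M" using False assms by (intro mult_mono) auto
      thus ?thesis using y2 x by simp
    qed
    hence y200: "200 \<le> y" by (rule power2_le_imp_le) (use y in simp)
    have "y ^ 4 \<le> 2 * M ^ 3" using assms(3) by (simp flip: y2)
    also have "\<dots> = y ^ 3 * (2 * w ^ 3)" by (simp add: M power_mult_distrib)
    finally have "y ^ 3 * y \<le> y ^ 3 * (2 * w ^ 3)" by (simp add: power4_eq_xxxx power3_eq_cube mult_ac)
    hence yw: "y \<le> 2 * w ^ 3" using y by (subst (asm) mult_le_cancel_left_pos) auto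
    have "(23 / 5) ^ 3 \<le> w ^ 3" using yw y200 by (simp add: power_divide)
    moreover have "w \<ge> 0" using x y by (simp add: w_def)
    ultimately have "23 / 5 \<le> w" by (subst (asm) power_mono_iff) auto
    from size_contradiction_far[OF yw this y200] show ?thesis
      using main g by (simp add: x_def)
  qed
qed

text \<open>
  With \<open>n\<close> the integer square root of \<open>N\<close>: primes up to \<open>n\<close> have surplus at most \<open>N\<close>, and
  there are at most \<open>n / 3\<close> of them; primes from there up to \<open>N / 5\<close> have surplus at most
  \<open>p\<close>, and their product is bounded by Chebyshev's estimate; the other primes up to \<open>m\<close>
  have no surplus.
\<close>
lemma prod_surplus_split_le:
  assumes "m \<ge> 24" "a > m" "2 * a + 2 * m - 1 \<le> m\<^sup>2"
  defines "N \<equiv> 2 * a + 2 * m - 1"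
  assumes "n\<^sup>2 \<le> N" "N < (n + 1)\<^sup>2" "n \<ge> 24"
  shows "(\<Prod>p\<in>odd_primes_upto m. surplus a m p) \<le> N ^ (n div 3) * 4 ^ min m (N div 5)"
proof -
  let ?small = "odd_primes_upto n"
  let ?big = "{p. prime p \<and> p \<le> min m (N div 5)}"
  have nm: "n \<le> m"
  proof -
    have "n\<^sup>2 \<le> m\<^sup>2" using assms(3,5) unfolding N_def by (rule order_trans[rotated])
    thus ?thesis by (simp only: power2_nat_le_eq_le)
  qed
  have E: "surplus a m p \<le> (if p \<in> ?small then N else if p \<in> ?big then p else 1)"
    if p: "p \<in> odd_primes_upto m" for p
  proof -
    have pr: "prime p" "3 \<le> p" "p \<le> m" using p by (auto simp: odd_primes_upto_def)
    consider "p \<le> n" | "p > n" "5 * p \<le> N" | "p > n" "N < 5 * p" by linarith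
    thus ?thesis
    proof cases
      case 1
      thus ?thesis using pr surplus_le[of p m a] assms(1)
        by (auto simp: odd_primes_upto_def N_def)
    next
      case 2
      have "(n + 1)\<^sup>2 \<le> p\<^sup>2" using 2 by (intro power_mono) auto
      hence "N < p\<^sup>2" using assms by linarith
      hence "surplus a m p \<le> p ^ 1"
        using pr by (intro surplus_le_power) (auto simp: N_def power2_eq_square)
      thus ?thesis using 2 pr by (auto simp: odd_primes_upto_def)
    next
      case 3
      have "(n + 1)\<^sup>2 \<le> p\<^sup>2" using 3 by (intro power_mono) auto
      hence "N < p\<^sup>2" using assms by linarith
      hence "surplus a m p = 1"
        using pr 3 assms(2) by (intro surplus_eq_1) (auto simp: N_def)
      thus ?thesis using 3 by (auto simp: odd_primes_upto_def dest: prime_gt_0_nat)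
    qed
  qed
  have sub: "?small \<subseteq> odd_primes_upto m" using nm by (auto simp: odd_primes_upto_def)
  have "(\<Prod>p\<in>odd_primes_upto m. surplus a m p)
      \<le> (\<Prod>p\<in>odd_primes_upto m. if p \<in> ?small then N else if p \<in> ?big then p else 1)"
    by (intro prod_mono conjI E) auto
  also have "\<dots> = (\<Prod>p\<in>?small. N) * (\<Prod>p\<in>odd_primes_upto m - ?small. if p \<in> ?big then p else 1)"
    using sub by (subst prod.subset_diff[of ?small]) (auto simp: mult.commute intro!: arg_cong2[of _ _ _ _ "(*)"] prod.cong)
  also have "(\<Prod>p\<in>?small. N) \<le> N ^ (n div 3)"
  proof -
    have "(\<Prod>p\<in>?small. N) = N ^ card ?small" by simp
    also have "\<dots> \<le> N ^ (n div 3)"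
      using assms by (intro power_increasing card_odd_primes_le[folded odd_primes_upto_def]) auto
    finally show ?thesis .
  qed
  also have "(\<Prod>p\<in>odd_primes_upto m - ?small. if p \<in> ?big then p else 1)
              = \<Prod>((odd_primes_upto m - ?small) \<inter> ?big)"
    by (subst prod.inter_restrict[symmetric]) auto
  also have "\<dots> \<le> \<Prod>?big"
    by (intro dvd_imp_le prod_dvd_prod_subset prod_pos) (auto dest: prime_gt_0_nat)
  also have "\<dots> \<le> 4 ^ min m (N div 5)" by (rule primorial_le)
  finally show ?thesis by simp
qed

text \<open>
  Logarithms turn the basic inequality, with the primes split at \<open>sqrt N\<close> and \<open>N / 5\<close>,
  into the opposite of \<open>size_contradiction\<close>.
\<close>
lemma no_smooth_window_huge:
  fixes a m :: nat
  assumes "m \<ge> 2048" "a > m" "2 * a + 2 * m - 1 \<le> 12 * m\<^sup>2 + 8 * m"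
  shows "\<not> odd_window_smooth a m"
proof
  assume smooth: "odd_window_smooth a m"
  define N where "N = 2 * a + 2 * m - 1"
  have N2: "N\<^sup>2 \<le> 2 * m ^ 3"
    unfolding N_def using assms smooth by (intro smooth_window_large) auto
  also have "\<dots> \<le> m * m ^ 3" using assms by simp
  also have "\<dots> = (m\<^sup>2)\<^sup>2" by (simp add: power2_eq_square power3_eq_cube)
  finally have Nm: "N \<le> m\<^sup>2" by (simp only: power2_nat_le_eq_le)
  have N4: "N \<ge> 4 * m" using assms by (simp add: N_def)
  define n where "n = nat \<lfloor>sqrt (real N)\<rfloor>"
  have n: "real n \<le> sqrt (real N)" "sqrt (real N) < real n + 1" by (auto simp: n_def)
  have "(real n)\<^sup>2 \<le> (sqrt (real N))\<^sup>2" using n by (intro power_mono) auto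
  hence n1: "n\<^sup>2 \<le> N" by (simp flip: of_nat_power)
  have "(sqrt (real N))\<^sup>2 < (real n + 1)\<^sup>2" using n by (intro power_strict_mono) auto
  hence "real N < real ((n + 1)\<^sup>2)" by (simp add: add.commute)
  hence n2: "N < (n + 1)\<^sup>2" by (simp only: of_nat_less_iff)
  have n24: "n \<ge> 24"
  proof (rule ccontr)
    assume "\<not> n \<ge> 24"
    hence "(n + 1)\<^sup>2 \<le> 24\<^sup>2" by (intro power_mono) auto
    thus False using n2 N4 assms by simp
  qed
  have "m\<^sup>2 < (m + 1)\<^sup>2" by (intro power_strict_mono) auto
  hence Nm1: "N < (m + 1)\<^sup>2" using Nm by linarith
  hence mid: "(\<Prod>p\<in>middle_primes m. surplus a m p) = 1"
    using assms(1,2) unfolding N_def by (intro prod_surplus_middle_eq_1) auto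
  have "(m + 1)\<^sup>2 \<le> (2 * m + 1)\<^sup>2" by (intro power_mono) auto
  hence "N < (2 * m + 1) ^ Suc 1" using Nm1 by (simp add: eval_nat_numeral)
  hence top: "(if prime (2 * m + 1) then surplus a m (2 * m + 1) else 1) \<le> 2 * m + 1"
    using surplus_if_prime_le[of a m "2 * m + 1" 1] unfolding N_def by simp
  have "N ^ m \<le> 2 * m ^ m * (\<Prod>p\<in>odd_primes_upto (2 * m + 1). surplus a m p)"
    unfolding N_def using assms smooth by (intro odd_window_smooth_bound) auto
  also have "(\<Prod>p\<in>odd_primes_upto (2 * m + 1). surplus a m p)
               \<le> (N ^ (n div 3) * 4 ^ min m (N div 5)) * 1 * (2 * m + 1)"
  proof (intro prod_odd_primes_upto_double_le top)
    show "(\<Prod>p\<in>odd_primes_upto m. surplus a m p) \<le> N ^ (n div 3) * 4 ^ min m (N div 5)"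
      unfolding N_def using assms(1,2) Nm n1 n2 n24
      by (intro prod_surplus_split_le) (simp_all add: N_def)
  qed (use mid assms(1) in simp_all)
  finally have "N ^ m \<le> 2 * m ^ m * (N ^ (n div 3) * 4 ^ min m (N div 5) * (2 * m + 1))" by simp
  hence "real (N ^ m) \<le> real (2 * m ^ m * (N ^ (n div 3) * 4 ^ min m (N div 5) * (2 * m + 1)))"
    by (simp only: of_nat_le_iff)
  also have "\<dots> = (4 * real m + 2) * real m ^ m * real N ^ (n div 3) * 4 ^ min m (N div 5)"
    by (simp add: algebra_simps)
  finally have "real N ^ m \<le> (4 * real m + 2) * real m ^ m * real N ^ (n div 3) * 4 ^ min m (N div 5)"
    by simp
  hence "ln (real N ^ m) \<le> ln ((4 * real m + 2) * real m ^ m * real N ^ (n div 3) * 4 ^ min m (N div 5))"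
    using assms N4 by (subst ln_le_cancel_iff) auto
  hence "real m * ln N \<le> ln (4 * real m + 2) + real m * ln m + real (n div 3) * ln N
                           + real (min m (N div 5)) * ln 4"
    using assms N4 by (simp add: ln_mult ln_realpow)
  moreover have "real (n div 3) * ln N \<le> sqrt N / 3 * ln N"
  proof -
    have "real (n div 3) \<le> real n / 3" using of_nat_div_le_of_nat[of n 3, where ?'a = real] by simp
    thus ?thesis using n N4 assms by (intro mult_right_mono) auto
  qed
  moreover have "real (min m (N div 5)) * ln 4 \<le> min (real m) (real N / 5) * ln 4"
  proof -
    have "real (N div 5) \<le> real N / 5" using of_nat_div_le_of_nat[of N 5, where ?'a = real] by simp
    thus ?thesis by (intro mult_right_mono) auto
  qed
  moreover have "real m * ln (real N / real m) = real m * ln N - real m * ln m"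
    using assms N4 by (simp add: ln_div algebra_simps)
  moreover have "ln (4 * real m + 2) + sqrt N / 3 * ln N + min (real m) (real N / 5) * ln 4
                  < real m * ln (real N / real m)"
  proof (rule size_contradiction)
    have "real (N\<^sup>2) \<le> real (2 * m ^ 3)" using N2 by (simp only: of_nat_le_iff)
    thus "(real N)\<^sup>2 \<le> 2 * (real m) ^ 3" by simp
  qed (use assms N4 in simp_all)
  ultimately show False by linarith
qed

section \<open>No smooth window for medium lengths\<close>

lemma prime_divisor_le_sqrt:
  fixes n :: nat
  assumes "n > 1" "\<not> prime n"
  shows "\<exists>q. prime q \<and> q dvd n \<and> q * q \<le> n \<and> q < n"
proof -
  obtain k where k: "k dvd n" "k \<noteq> 1" "k \<noteq> n"
    using assms by (auto simp: prime_nat_iff)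
  then obtain l where l: "n = k * l" by blast
  define c where "c = min k l"
  have c: "c dvd n" "c * c \<le> n" "c \<noteq> 1"
    using k l assms by (auto simp: c_def min_def intro: mult_le_mono)
  then obtain q where q: "prime q" "q dvd c" using prime_factor_nat by blast
  have "c > 0" using c assms by (auto intro: gr0I)
  hence "q \<le> c" using q dvd_imp_le by blast
  hence "q * q \<le> n" using c by (meson le_trans mult_le_mono)
  moreover have "q < q * q" using prime_gt_1_nat[OF q(1)] by simp
  moreover have "q dvd n" using q c dvd_trans by blast
  ultimately show ?thesis using q(1) by (intro exI[of _ q]) linarith
qed

text \<open>
  The primes below \<open>367\<close> decide primality of all numbers below \<open>367\<^sup>2 = 134689\<close>, which
  covers all chains below.
\<close>
definition small_primes :: "nat list" where
  "small_primes =
     [2, 3, 5, 7, 11, 13, 17, 19, 23, 29, 31, 37, 41, 43, 47, 53, 59, 61, 67, 71, 73, 79, 83,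
      89, 97, 101, 103, 107, 109, 113, 127, 131, 137, 139, 149, 151, 157, 163, 167, 173, 179,
      181, 191, 193, 197, 199, 211, 223, 227, 229, 233, 239, 241, 251, 257, 263, 269, 271,
      277, 281, 283, 293, 307, 311, 313, 317, 331, 337, 347, 349, 353, 359]"

lemma sorted_small_primes: "sorted small_primes"
  by code_simp

lemma small_primes_bound: "list_all (\<lambda>p. p < 367) small_primes"
  by code_simp

text \<open>
  A number below \<open>20\<^sup>2\<close> is prime unless it has a proper prime divisor below \<open>20\<close>.
\<close>
lemma prime_less_367_iff: "prime p \<and> p < 367 \<longleftrightarrow> p \<in> set small_primes"
proof -
  let ?D = "{2, 3, 5, 7, 11, 13, 17, 19}"
  have "list_all (\<lambda>n. n \<in> set small_primes \<longleftrightarrow>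
          1 < n \<and> (\<forall>q\<in>set [2, 3, 5, 7, 11, 13, 17, 19]. q dvd n \<longrightarrow> q = n)) [0..<367]"
    by code_simp
  hence list: "n \<in> set small_primes \<longleftrightarrow> 1 < n \<and> (\<forall>q\<in>?D. q dvd n \<longrightarrow> q = n)" if "n < 367" for n
    using that unfolding list_all_iff by simp
  have "list_all (\<lambda>q. q < 2 \<or> q \<in> set [2, 3, 5, 7, 11, 13, 17, 19] \<or>
          (\<exists>d\<in>set [2, 3]. d dvd q \<and> d < q)) [0..<20::nat]"
    by code_simp
  hence split: "q < 2 \<or> q \<in> ?D \<or> (\<exists>d\<in>{2, 3}. d dvd q \<and> d < q)" if "q < 20" for q :: nat
    using that unfolding list_all_iff by simp
  have D: "q \<in> ?D" if q: "prime q" "q < 20" for q :: nat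
  proof -
    have "\<not> (\<exists>d\<in>{2, 3}. d dvd q \<and> d < q)"
      using primes_dvd_imp_eq[of 2 q] primes_dvd_imp_eq[of 3 q] q by auto
    thus ?thesis using split[OF q(2)] prime_ge_2_nat[OF q(1)] by linarith
  qed
  have bound: "p < 367" if "p \<in> set small_primes" for p
    using that small_primes_bound by (auto simp: list_all_iff)
  show ?thesis
  proof
    assume p: "prime p \<and> p < 367"
    hence "\<forall>q\<in>?D. q dvd p \<longrightarrow> q = p"
      by (auto simp: prime_nat_iff)
    moreover have "1 < p" using p prime_gt_1_nat by blast
    ultimately show "p \<in> set small_primes" by (subst list) (use p in simp_all)
  next
    assume p: "p \<in> set small_primes"
    have p1: "1 < p" and D': "\<forall>q\<in>?D. q dvd p \<longrightarrow> q = p"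
      using iffD1[OF list[OF bound[OF p]] p] by blast+
    have "prime p"
    proof (rule ccontr)
      assume "\<not> prime p"
      then obtain q where q: "prime q" "q dvd p" "q * q \<le> p" "q < p"
        using prime_divisor_le_sqrt[OF p1] by blast
      have "q < 20"
      proof (rule ccontr)
        assume "\<not> q < 20"
        hence "20 * 20 \<le> q * q" by (intro mult_le_mono) auto
        thus False using q(3) bound[OF p] by linarith
      qed
      hence "q \<in> ?D" using D q(1) by blast
      hence "q = p" using D' q(2) by blast
      thus False using q(4) by simp
    qed
    thus "prime p \<and> p < 367" using bound[OF p] by blast
  qed
qed

text \<open>
  Trial division by an increasing list, stopping at the square root; the conditional makes
  the evaluation stop there as well.
\<close>
fun passes_trial :: "nat list \<Rightarrow> nat \<Rightarrow> bool" where
  "passes_trial [] p = True"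
| "passes_trial (q # qs) p = (if p < q * q then True else p mod q \<noteq> 0 \<and> passes_trial qs p)"

lemma passes_trial_not_dvd:
  "passes_trial qs p \<Longrightarrow> sorted qs \<Longrightarrow> q \<in> set qs \<Longrightarrow> q * q \<le> p \<Longrightarrow> \<not> q dvd p"
proof (induction qs)
  case (Cons q' qs)
  have "\<not> p < q' * q'"
  proof
    assume "p < q' * q'"
    also have "q' * q' \<le> q * q" using Cons.prems by (intro mult_le_mono) auto
    finally show False using Cons.prems by simp
  qed
  thus ?case using Cons by (auto simp: dvd_eq_mod_eq_0)
qed simp

definition trial_prime :: "nat \<Rightarrow> bool" where
  "trial_prime p \<longleftrightarrow> 2 < p \<and> p < 367 * 367 \<and> passes_trial small_primes p"

lemma trial_prime_imp_prime:
  assumes "trial_prime p"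
  shows "prime p"
proof (rule ccontr)
  assume "\<not> prime p"
  then obtain q where q: "prime q" "q dvd p" "q * q \<le> p" "q < p"
    using prime_divisor_le_sqrt[of p] assms by (auto simp: trial_prime_def)
  have "q < 367"
  proof (rule ccontr)
    assume "\<not> q < 367"
    hence "367 * 367 \<le> q * q" by (intro mult_le_mono) auto
    thus False using q assms by (simp add: trial_prime_def)
  qed
  hence "q \<in> set small_primes" using q prime_less_367_iff by blast
  thus False
    using passes_trial_not_dvd[OF _ sorted_small_primes, of p q] q assms
    by (simp add: trial_prime_def)
qed

lemma successively_straddle:
  assumes "successively R xs" "xs \<noteq> []" "hd xs \<le> n" "n < last xs"
  shows "\<exists>x\<in>set xs. \<exists>y\<in>set xs. R x y \<and> x \<le> n \<and> n < (y::nat)"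
  using assms
proof (induction xs rule: induct_list012)
  case (3 x y zs)
  show ?case
  proof (cases "y \<le> n")
    case True
    hence "\<exists>x\<in>set (y # zs). \<exists>y\<in>set (y # zs). R x y \<and> x \<le> n \<and> n < y"
      using 3 by (intro 3(2)) auto
    thus ?thesis by auto
  qed (use 3 in auto)
qed auto

text \<open>
  Take the members \<open>x\<close> and \<open>y\<close> of the chain next to \<open>2 * a\<close> on either side. If \<open>y\<close>
  belonged to the window, its large prime factor would contradict smoothness, so the
  window lies in the gap between \<open>x\<close> and \<open>y\<close>.
\<close>
lemma smooth_window_gap:
  assumes smooth: "odd_window_smooth a m"
    and chain: "successively R xs" "xs \<noteq> []" "hd xs \<le> 2 * a" "2 * a < last xs"
    and odd: "\<And>y. y \<in> set xs \<Longrightarrow> odd y"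
    and big: "\<And>y. y \<in> set xs \<Longrightarrow> 2 * a < y \<Longrightarrow> \<exists>p. prime p \<and> p > 2 * m + 1 \<and> p dvd y"
  shows "\<exists>x y. R x y \<and> x < 2 * a \<and> 2 * a + 2 * m < y"
proof -
  obtain x y where xy: "x \<in> set xs" "y \<in> set xs" "R x y" "x \<le> 2 * a" "2 * a < y"
    using successively_straddle[OF chain] by blast
  have "x \<noteq> 2 * a" using odd[OF xy(1)] by auto
  moreover have "2 * a + 2 * m < y"
  proof (rule ccontr)
    assume "\<not> 2 * a + 2 * m < y"
    moreover obtain k where k: "y = 2 * k + 1" using odd[OF xy(2)] oddE by blast
    ultimately have "y = 2 * a + 1 + 2 * (k - a)" "k - a < m" using xy(5) by auto
    moreover obtain p where "prime p" "p > 2 * m + 1" "p dvd y" using big xy by blast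
    ultimately show False
      using smooth unfolding odd_window_smooth_def by (metis not_le)
  qed
  ultimately show ?thesis using xy by force
qed

lemma smooth_window_prime_gap:
  assumes smooth: "odd_window_smooth a m" and "a > m"
    and chain: "successively R xs" "xs \<noteq> []" "hd xs \<le> 2 * a" "2 * a < last xs"
    and prime: "list_all trial_prime xs"
  shows "\<exists>x y. R x y \<and> x < 2 * a \<and> 2 * a + 2 * m < y"
proof (rule smooth_window_gap[OF smooth chain])
  fix y assume y: "y \<in> set xs"
  hence t: "trial_prime y" using prime by (auto simp: list_all_iff)
  hence p: "prime y" by (rule trial_prime_imp_prime)
  show "odd y" using p t by (simp add: odd_prime_nat_iff trial_prime_def)
  assume "2 * a < y"
  thus "\<exists>p. prime p \<and> p > 2 * m + 1 \<and> p dvd y" using p assms by (intro exI[of _ y]) auto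
qed

text \<open>
  A gap between odd numbers \<open>x < y\<close> contains windows of length up to
  \<open>h = (y - x) div 2 - 1\<close>. Such a gap is harmless if \<open>h\<close> is below the range of \<open>m\<close> or if
  \<open>192 * h ^ 3 \<le> x\<^sup>2\<close>, since smooth windows satisfy \<open>x\<^sup>2 < N\<^sup>2 \<le> 192 * m ^ 3\<close>.
\<close>
definition medium_gap :: "nat \<Rightarrow> nat \<Rightarrow> bool" where
  "medium_gap x y \<longleftrightarrow> (let h = (y - x) div 2 - 1 in h < 24 \<or> 192 * h ^ 3 \<le> x\<^sup>2)"

text \<open>
  Each member is the largest prime that can follow its predecessor. The last member
  exceeds the square root of \<open>192 * 191 ^ 3\<close>.
\<close>
definition chain_medium :: "nat list" where
  "chain_medium =
     [47, 89, 137, 181, 229, 277, 317, 359, 401, 449, 491, 523, 571, 619, 661, 709, 757, 797,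
      839, 887, 929, 977, 1021, 1069, 1117, 1163, 1201, 1249, 1297, 1327, 1373, 1409, 1453,
      1499, 1543, 1583, 1627, 1669, 1709, 1759, 1811, 1861, 1913, 1951, 2003, 2053, 2111,
      2161, 2213, 2273, 2333, 2393, 2447, 2503, 2557, 2621, 2687, 2753, 2819, 2887, 2957,
      3023, 3089, 3163, 3229, 3301, 3373, 3449, 3529, 3607, 3677, 3761, 3833, 3919, 4007,
      4093, 4177, 4261, 4349, 4441, 4523, 4603, 4691, 4789, 4889, 4987, 5087, 5189, 5281,
      5387, 5483, 5591, 5701, 5813, 5927, 6037, 6151, 6269, 6379, 6491, 6607, 6719, 6841,
      6967, 7079, 7207, 7333, 7459, 7591, 7723, 7853, 7963, 8101, 8237, 8377, 8521, 8663,
      8807, 8951, 9091, 9241, 9391, 9547, 9697, 9851, 10009, 10169, 10333, 10499, 10667,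
      10831, 10993, 11161, 11329, 11503, 11681, 11839, 12011, 12163, 12347, 12527, 12713,
      12899, 13063, 13249, 13441, 13633, 13831, 14029, 14221, 14423, 14629, 14831, 15031,
      15241, 15451, 15667, 15881, 16097, 16319, 16529, 16747, 16963, 17191, 17419, 17627,
      17863, 18097, 18329, 18553, 18797, 19037, 19273, 19507, 19759, 20011, 20261, 20509,
      20759, 21019, 21283, 21529, 21799, 22067, 22307, 22573, 22817, 23087, 23369, 23633,
      23917, 24203, 24481, 24767, 25057, 25349, 25643, 25943, 26237, 26539, 26849, 27143,
      27457, 27773, 28087, 28409, 28729, 29033, 29347, 29671, 29989, 30323, 30661, 30983,
      31321, 31667, 32009, 32359, 32713, 33053, 33409, 33769, 34129, 34487, 34849, 35201,
      35573, 35933, 36307, 36683]"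

lemma chain_medium_prime: "list_all trial_prime chain_medium"
  by code_simp

lemma chain_medium_gap: "successively medium_gap chain_medium"
  by code_simp

lemma chain_medium_ends: "chain_medium \<noteq> []" "hd chain_medium = 47" "last chain_medium = 36683"
  by code_simp+

lemma no_smooth_window_medium:
  assumes "24 \<le> m" "m < 192" "a > m" "2 * a + 2 * m - 1 \<le> 12 * m\<^sup>2 + 8 * m"
  shows "\<not> odd_window_smooth a m"
proof
  assume smooth: "odd_window_smooth a m"
  define N where "N = 2 * a + 2 * m - 1"
  have N: "N\<^sup>2 \<le> 192 * m ^ 3"
    unfolding N_def using assms smooth by (intro smooth_window_medium) auto
  also have "\<dots> \<le> 192 * 191 ^ 3"
    using assms by (intro mult_le_mono2 power_mono) auto
  also have "\<dots> < 36683\<^sup>2" by simp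
  finally have "N < 36683" by (rule power_less_imp_less_base) simp
  hence "\<exists>x y. medium_gap x y \<and> x < 2 * a \<and> 2 * a + 2 * m < y"
    using assms by (intro smooth_window_prime_gap[OF smooth _ chain_medium_gap])
      (auto simp: chain_medium_prime chain_medium_ends N_def)
  then obtain x y where xy: "medium_gap x y" "x < 2 * a" "2 * a + 2 * m < y" by blast
  define h where "h = (y - x) div 2 - 1"
  \<comment> \<open>The window lies strictly between \<open>x\<close> and \<open>y\<close>, so its length is at most \<open>h\<close>.\<close>
  have h: "m \<le> h" using xy unfolding h_def by linarith
  hence "192 * h ^ 3 \<le> x\<^sup>2" using xy(1) assms by (auto simp: medium_gap_def h_def Let_def)
  moreover have "192 * m ^ 3 \<le> 192 * h ^ 3" using h by (intro mult_le_mono2 power_mono) auto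
  moreover have "x\<^sup>2 < N\<^sup>2" using xy assms by (intro power_strict_mono) (auto simp: N_def)
  ultimately show False using N by linarith
qed

text \<open>
  As before, but for windows with \<open>m \<ge> 192\<close>, which satisfy \<open>N\<^sup>2 \<le> 2 * m ^ 3\<close>.
\<close>
definition large_gap :: "nat \<Rightarrow> nat \<Rightarrow> bool" where
  "large_gap x y \<longleftrightarrow> (let h = (y - x) div 2 - 1 in h < 192 \<or> 2 * h ^ 3 \<le> x\<^sup>2)"

definition chain_large :: "nat list" where
  "chain_large =
     [383, 761, 1129, 1511, 1889, 2273, 2657, 3041, 3413, 3797, 4177, 4583, 5021, 5483, 5953,
      6473, 7019, 7591, 8191, 8837, 9511, 10223, 10957, 11731, 12547, 13399, 14293, 15227,
      16193, 17209, 18269, 19333, 20477, 21661, 22877, 24151, 25471, 26839, 28229, 29683,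
      31193, 32749, 34369, 36037, 37747, 39521, 41357, 43237, 45191, 47189, 49261, 51383,
      53569, 55823, 58129, 60509, 62939, 65449, 68023, 70667, 73379, 76163, 78989, 81901,
      84871, 87931, 91033, 94229, 97511, 100853, 104287, 107791, 111373, 115021, 118757,
      122579, 126493, 130489, 134513]"

lemma chain_large_prime: "list_all trial_prime chain_large"
  by code_simp

lemma chain_large_gap: "successively large_gap chain_large"
  by code_simp

lemma chain_large_ends: "chain_large \<noteq> []" "hd chain_large = 383" "last chain_large = 134513"
  by code_simp+

lemma no_smooth_window_large:
  assumes "192 \<le> m" "m < 2048" "a > m" "2 * a + 2 * m - 1 \<le> 12 * m\<^sup>2 + 8 * m"
  shows "\<not> odd_window_smooth a m"
proof
  assume smooth: "odd_window_smooth a m"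
  define N where "N = 2 * a + 2 * m - 1"
  have N: "N\<^sup>2 \<le> 2 * m ^ 3"
    unfolding N_def using assms smooth by (intro smooth_window_large) auto
  also have "\<dots> \<le> 2 * 2047 ^ 3"
    using assms by (intro mult_le_mono2 power_mono) auto
  also have "\<dots> < 134513\<^sup>2" by simp
  finally have "N < 134513" by (rule power_less_imp_less_base) simp
  hence "\<exists>x y. large_gap x y \<and> x < 2 * a \<and> 2 * a + 2 * m < y"
    using assms by (intro smooth_window_prime_gap[OF smooth _ chain_large_gap])
      (auto simp: chain_large_prime chain_large_ends N_def)
  then obtain x y where xy: "large_gap x y" "x < 2 * a" "2 * a + 2 * m < y" by blast
  define h where "h = (y - x) div 2 - 1"
  have h: "m \<le> h" using xy unfolding h_def by linarith
  hence "2 * h ^ 3 \<le> x\<^sup>2" using xy(1) assms by (auto simp: large_gap_def h_def Let_def)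
  moreover have "2 * m ^ 3 \<le> 2 * h ^ 3" using h by (intro mult_le_mono2 power_mono) auto
  moreover have "x\<^sup>2 < N\<^sup>2" using xy assms by (intro power_strict_mono) (auto simp: N_def)
  ultimately show False using N by linarith
qed

section \<open>No smooth window for small lengths\<close>

text \<open>
  For a prime strictly between \<open>m\<close> and \<open>2 * m\<close> even \<open>p\<close> times its surplus is at most \<open>N\<close>.
  Keeping these factors makes the inequality effective for small \<open>m\<close>.
\<close>
lemma small_window_bound:
  assumes "m \<ge> 2" "a \<ge> m" "odd_window_smooth a m"
  shows "(2 * a + 2 * m - 1) ^ m * \<Prod>(middle_primes m)
           \<le> 2 * m ^ m * (2 * a + 2 * m - 1) ^ card (odd_primes_upto (2 * m + 1))"
proof -
  let ?N = "2 * a + 2 * m - 1" and ?S = "odd_primes_upto (2 * m + 1)"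
  let ?g = "\<lambda>p. if p \<in> middle_primes m then p else 1"
  have "middle_primes m \<subseteq> ?S" using assms(1) by (auto simp: odd_primes_upto_def middle_primes_def)
  hence g: "(\<Prod>p\<in>?S. ?g p) = \<Prod>(middle_primes m)"
    by (intro prod.mono_neutral_cong_right) auto
  have "?N ^ m * \<Prod>(middle_primes m) \<le> (2 * m ^ m * (\<Prod>p\<in>?S. surplus a m p)) * \<Prod>(middle_primes m)"
    using assms by (intro mult_le_mono1 odd_window_smooth_bound) auto
  also have "\<dots> = 2 * m ^ m * (\<Prod>p\<in>?S. surplus a m p * ?g p)"
    unfolding g[symmetric] prod.distrib by (simp only: mult_ac)
  also have "(\<Prod>p\<in>?S. surplus a m p * ?g p) \<le> (\<Prod>p\<in>?S. ?N)"
  proof (intro prod_mono conjI)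
    fix p assume "p \<in> ?S"
    hence p: "prime p" "3 \<le> p" by (auto simp: odd_primes_upto_def)
    show "surplus a m p * ?g p \<le> ?N"
      using surplus_le[OF p(1), of m a] surplus_mult_le[OF p, of m a] assms
      by (auto simp: middle_primes_def)
  qed auto
  finally show ?thesis by simp
qed

definition small_odd_primes :: "nat list" where
  "small_odd_primes = [3, 5, 7, 11, 13, 17, 19, 23, 29, 31, 37, 41, 43, 47]"

lemma small_odd_primes_iff: "prime p \<and> 3 \<le> p \<and> p \<le> 47 \<longleftrightarrow> p \<in> set small_odd_primes"
proof -
  have "set small_odd_primes = set (filter (\<lambda>p. 3 \<le> p \<and> p \<le> 47) small_primes)"
    by (simp add: small_odd_primes_def small_primes_def)
  hence "p \<in> set small_odd_primes \<longleftrightarrow> (prime p \<and> p < 367) \<and> 3 \<le> p \<and> p \<le> 47"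
    by (simp only: set_filter mem_Collect_eq prime_less_367_iff)
  thus ?thesis by auto
qed

text \<open>
  If \<open>N > B\<close>, then the basic inequality for \<open>m\<close>, with the actual primes up to \<open>2 * m + 1\<close>
  and after cancelling their number \<open>u\<close> of factors \<open>N\<close>, is violated.
\<close>
definition small_window_cutoff :: "nat \<Rightarrow> nat \<Rightarrow> bool" where
  "small_window_cutoff m B \<longleftrightarrow>
     (let u = length (filter (\<lambda>p. p \<le> 2 * m + 1) small_odd_primes);
          R = prod_list (filter (\<lambda>p. m < p \<and> p < 2 * m) small_odd_primes)
      in u \<le> m \<and> 2 * m ^ m < (B + 1) ^ (m - u) * R)"

lemma small_window_le:
  assumes "2 \<le> m" "m \<le> 23" "a \<ge> m" "odd_window_smooth a m" "small_window_cutoff m B"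
  shows "2 * a + 2 * m - 1 \<le> B"
proof (rule ccontr)
  let ?N = "2 * a + 2 * m - 1"
  let ?u = "length (filter (\<lambda>p. p \<le> 2 * m + 1) small_odd_primes)"
  let ?R = "prod_list (filter (\<lambda>p. m < p \<and> p < 2 * m) small_odd_primes)"
  assume "\<not> ?N \<le> B"
  hence N: "B + 1 \<le> ?N" by simp
  have max: "?u \<le> m" "2 * m ^ m < (B + 1) ^ (m - ?u) * ?R"
    using assms(5) by (auto simp: small_window_cutoff_def Let_def)
  have dist: "distinct small_odd_primes" by (simp add: small_odd_primes_def)
  have "odd_primes_upto (2 * m + 1) = set (filter (\<lambda>p. p \<le> 2 * m + 1) small_odd_primes)"
  proof (rule Set.set_eqI)
    fix p
    have "p \<in> odd_primes_upto (2 * m + 1) \<longleftrightarrow> (prime p \<and> 3 \<le> p \<and> p \<le> 47) \<and> p \<le> 2 * m + 1"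
      using assms(2) by (auto simp: odd_primes_upto_def)
    thus "p \<in> odd_primes_upto (2 * m + 1) \<longleftrightarrow>
            p \<in> set (filter (\<lambda>p. p \<le> 2 * m + 1) small_odd_primes)"
      by (simp only: small_odd_primes_iff set_filter mem_Collect_eq)
  qed
  hence u: "card (odd_primes_upto (2 * m + 1)) = ?u"
    using dist by (simp only: distinct_card distinct_filter)
  have "middle_primes m = set (filter (\<lambda>p. m < p \<and> p < 2 * m) small_odd_primes)"
  proof (rule Set.set_eqI)
    fix p
    have "p \<in> middle_primes m \<longleftrightarrow> (prime p \<and> 3 \<le> p \<and> p \<le> 47) \<and> m < p \<and> p < 2 * m"
      using assms(1,2) by (auto simp: middle_primes_def)
    thus "p \<in> middle_primes m \<longleftrightarrow>
            p \<in> set (filter (\<lambda>p. m < p \<and> p < 2 * m) small_odd_primes)"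
      by (simp only: small_odd_primes_iff set_filter mem_Collect_eq)
  qed
  hence R: "\<Prod>(middle_primes m) = ?R"
    using dist prod.distinct_set_conv_list[of "filter (\<lambda>p. m < p \<and> p < 2 * m) small_odd_primes" "\<lambda>p. p"]
    by (simp only: distinct_filter list.map_ident)
  have "?N ^ ?u * (?N ^ (m - ?u) * ?R) = ?N ^ m * ?R"
    using max(1) by (simp flip: power_add mult.assoc)
  also have "\<dots> \<le> 2 * m ^ m * ?N ^ ?u"
    using small_window_bound[of m a] assms(1,3,4) u R by simp
  also have "\<dots> < (B + 1) ^ (m - ?u) * ?R * ?N ^ ?u"
    using max(2) assms(1) by (intro mult_strict_right_mono) auto
  also have "\<dots> \<le> ?N ^ (m - ?u) * ?R * ?N ^ ?u"
    using N by (intro mult_le_mono1 power_mono) auto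
  finally show False by (simp only: mult_ac)
qed

text \<open>
  For \<open>m = 4\<close> the cutoff is below the smallest window. For \<open>m = 5\<close> and \<open>m = 6\<close> the
  quadratic bound on \<open>N\<close> is sharper than any cutoff, and for \<open>m = 2\<close> and \<open>m = 3\<close> there is
  no cutoff.
\<close>
lemma small_window_cutoffs:
  "small_window_cutoff 4 16" "small_window_cutoff 7 107" "small_window_cutoff 8 484"
  "list_all (\<lambda>m. small_window_cutoff m 565) [9..<24]"
  by code_simp+

text \<open>
  A chain for a single \<open>m\<close>. Its members need not be prime, a prime factor greater than
  \<open>2 * m + 1\<close> is enough. The first member \<open>2 * m + 1\<close> is exempt: it lies below all
  windows.
\<close>
definition chain_for :: "nat \<Rightarrow> nat list \<Rightarrow> bool" where
  "chain_for m xs \<longleftrightarrow> xs \<noteq> [] \<and> hd xs = 2 * m + 1 \<and>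
     list_all (\<lambda>y. odd y \<and> (y = 2 * m + 1 \<or> list_ex (\<lambda>p. 2 * m + 1 < p \<and> p dvd y) small_primes)) xs"

lemma smooth_window_small_gap:
  assumes "odd_window_smooth a m" "a > m" "chain_for m xs" "successively R xs" "2 * a < last xs"
  shows "\<exists>x y. R x y \<and> x < 2 * a \<and> 2 * a + 2 * m < y"
proof (rule smooth_window_gap[OF assms(1,4) _ _ assms(5)])
  fix y assume y: "y \<in> set xs"
  thus "odd y" using assms(3) by (auto simp: chain_for_def list_all_iff)
  assume "2 * a < y"
  hence "y \<noteq> 2 * m + 1" using assms(2) by simp
  then obtain p where "p \<in> set small_primes" "2 * m + 1 < p" "p dvd y"
    using y assms(3) by (auto simp: chain_for_def list_all_iff list_ex_iff)
  thus "\<exists>p. prime p \<and> p > 2 * m + 1 \<and> p dvd y" using prime_less_367_iff by blast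
qed (use assms in \<open>auto simp: chain_for_def\<close>)

lemma no_smooth_window_chain:
  assumes "a > m" "chain_for m xs" "successively (\<lambda>x y. y \<le> x + 2 * m) xs" "2 * a < last xs"
  shows "\<not> odd_window_smooth a m"
proof
  assume "odd_window_smooth a m"
  from smooth_window_small_gap[OF this assms] obtain x y
    where "y \<le> x + 2 * m" "x < 2 * a" "2 * a + 2 * m < y" by blast
  thus False by linarith
qed

definition chain_2 :: "nat list" where
  "chain_2 =
     [5, 7, 11, 13, 17, 21, 23, 29, 33, 37, 41, 43, 47, 51, 55, 59, 63, 67]"

definition chain_3 :: "nat list" where
  "chain_3 =
     [7, 13, 19, 23, 29, 33, 39, 43, 47, 53, 59, 65, 71, 77, 83, 89, 95, 101, 107, 113, 119,
      123, 129, 133]"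

definition chain_5 :: "nat list" where
  "chain_5 =
     [11, 19, 29, 39, 47, 57, 67, 73, 83, 93, 103, 113, 123, 133, 143, 153, 163, 173, 183,
      193, 203, 213, 223, 233, 241, 251, 261, 271, 281, 291, 301, 311, 321, 331, 341]"

definition chain_6 :: "nat list" where
  "chain_6 =
     [13, 23, 31, 43, 53, 61, 73, 85, 97, 109, 119, 131, 141, 153, 163, 173, 185, 197, 209,
      221, 233, 241, 253, 265, 277, 289, 301, 313, 323, 335, 347, 359, 371, 381, 393, 403,
      415, 427, 437, 447, 459, 471, 483]"

definition chain_7 :: "nat list" where
  "chain_7 =
     [15, 29, 43, 57, 71, 85, 97, 111]"

definition chain_8 :: "nat list" where
  "chain_8 =
     [17, 31, 47, 61, 73, 89, 103, 115, 131, 145, 161, 177, 193, 209, 223, 239, 253, 269, 285,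
      301, 317, 333, 349, 365, 381, 395, 411, 427, 437, 453, 469, 485]"

lemma chains_for:
  "chain_for 2 chain_2" "chain_for 3 chain_3" "chain_for 5 chain_5"
  "chain_for 6 chain_6" "chain_for 7 chain_7" "chain_for 8 chain_8"
  by code_simp+

text \<open>
  For \<open>m = 2\<close> the gap from \<open>23\<close> to \<open>29\<close> contains the exceptional window \<open>25, 27\<close>.
\<close>
lemma chain_gaps:
  "successively (\<lambda>x y. y \<le> x + 2 * 2 \<or> x = 23 \<and> y = 29) chain_2"
  "successively (\<lambda>x y. y \<le> x + 2 * 3) chain_3" "successively (\<lambda>x y. y \<le> x + 2 * 5) chain_5"
  "successively (\<lambda>x y. y \<le> x + 2 * 6) chain_6" "successively (\<lambda>x y. y \<le> x + 2 * 7) chain_7"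
  "successively (\<lambda>x y. y \<le> x + 2 * 8) chain_8"
  by code_simp+

text \<open>
  Primes with gaps at most \<open>18\<close>, for windows with \<open>m \<ge> 9\<close>.
\<close>
definition chain_low :: "nat list" where
  "chain_low =
     [19, 37, 53, 71, 89, 107, 113, 131, 149, 167, 181, 199, 211, 229, 241, 257, 271, 283,
      293, 311, 317, 331, 349, 367, 383, 401, 419, 433, 449, 467, 479, 491, 509, 523, 541,
      557, 571]"

lemma chain_low_prime: "list_all trial_prime chain_low"
  by code_simp

lemma chain_low_gap: "successively (\<lambda>x y. y \<le> x + 18) chain_low"
  by code_simp

lemma chain_low_ends: "chain_low \<noteq> []" "hd chain_low = 19" "last chain_low = 571"
  by code_simp+

lemma no_smooth_window_small:
  assumes "2 \<le> m" "m < 24" "a > m" "2 * a + 2 * m - 1 \<le> 12 * m\<^sup>2 + 8 * m"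
    and "(m, a) \<noteq> (2, 12)"
  shows "\<not> odd_window_smooth a m"
proof
  assume smooth: "odd_window_smooth a m"
  consider "m = 2" | "m = 3" | "m = 4" | "m = 5" | "m = 6" | "m = 7" | "m = 8" | "9 \<le> m"
    using assms by linarith
  thus False
  proof cases
    case 1
    hence "2 * a < last chain_2" using assms(4) by (simp add: chain_2_def)
    from smooth_window_small_gap[OF smooth assms(3) chains_for(1)[folded 1] chain_gaps(1) this] 1
    show False using assms(5) by auto
  next
    case 2
    hence "2 * a < last chain_3" using assms(4) by (simp add: chain_3_def)
    thus False using smooth no_smooth_window_chain[of 3 a chain_3] assms 2 chains_for chain_gaps by simp
  next
    case 3
    thus False using smooth small_window_le[of m a 16] assms small_window_cutoffs by simp
  next
    case 4
    hence "2 * a < last chain_5" using assms(4) by (simp add: chain_5_def)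
    thus False using smooth no_smooth_window_chain[of 5 a chain_5] assms 4 chains_for chain_gaps by simp
  next
    case 5
    hence "2 * a < last chain_6" using assms(4) by (simp add: chain_6_def)
    thus False using smooth no_smooth_window_chain[of 6 a chain_6] assms 5 chains_for chain_gaps by simp
  next
    case 6
    have "2 * a + 2 * m - 1 \<le> 107"
      using smooth 6 assms small_window_cutoffs by (intro small_window_le) auto
    hence "2 * a < last chain_7" using 6 by (simp add: chain_7_def)
    thus False using smooth no_smooth_window_chain[of 7 a chain_7] assms 6 chains_for chain_gaps by simp
  next
    case 7
    have "2 * a + 2 * m - 1 \<le> 484"
      using smooth 7 assms small_window_cutoffs by (intro small_window_le) auto
    hence "2 * a < last chain_8" using 7 by (simp add: chain_8_def)
    thus False using smooth no_smooth_window_chain[of 8 a chain_8] assms 7 chains_for chain_gaps by simp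
  next
    case 8
    hence "m \<in> set [9..<24]"
      using assms(2) by (simp only: set_upt atLeastLessThan_iff)
    hence "small_window_cutoff m 565"
      using small_window_cutoffs(4) unfolding list_all_iff by blast
    hence "2 * a + 2 * m - 1 \<le> 565"
      using smooth assms by (intro small_window_le) auto
    hence "\<exists>x y. y \<le> x + 18 \<and> x < 2 * a \<and> 2 * a + 2 * m < y"
      using 8 assms by (intro smooth_window_prime_gap[OF smooth _ chain_low_gap])
        (auto simp: chain_low_prime chain_low_ends)
    thus False using 8 by auto
  qed
qed

text \<open>
  Schur's theorem for windows of at most quadratic size. The window with \<open>m = 2\<close> and
  \<open>a = 12\<close> consists of \<open>25\<close> and \<open>27\<close>.
\<close>
theorem odd_window_prime_factor:
  fixes a m :: nat
  assumes "2 \<le> m" "a > m" "2 * a + 2 * m - 1 \<le> 12 * m\<^sup>2 + 8 * m" "(m, a) \<noteq> (2, 12)"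
  shows "\<exists>p j. prime p \<and> j < m \<and> p > 2 * m + 1 \<and> p dvd 2 * a + 1 + 2 * j"
proof -
  have "\<not> odd_window_smooth a m"
    using assms no_smooth_window_small no_smooth_window_medium no_smooth_window_large
      no_smooth_window_huge by (meson not_le)
  thus ?thesis by (auto simp: odd_window_smooth_def not_le)
qed

section \<open>Windows of consecutive integers far from the origin\<close>

lemma five_power_growth: "n \<ge> 2 \<Longrightarrow> 5 ^ n * (2 * n + 1) < (13::nat) ^ n"
proof (induction n rule: nat_induct_at_least)
  case (Suc n)
  have "5 ^ Suc n * (2 * Suc n + 1) \<le> 13 * (5 ^ n * (2 * n + 1))"
    using Suc.hyps by (simp add: algebra_simps)
  also have "\<dots> < 13 * 13 ^ n" using Suc.IH by simp
  finally show ?case by simp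
qed simp

text \<open>
  Otherwise the binomial coefficient \<open>(s + k) choose k\<close> is composed of the at most \<open>n + 1\<close>
  primes up to \<open>k\<close>, each contributing at most \<open>N = s + k\<close>. It is at least \<open>(N / k) ^ k\<close>,
  so \<open>N ^ n \<le> k ^ k\<close>. As \<open>k = 2 * n + 1\<close>, this contradicts the size of \<open>N\<close>.
\<close>
lemma long_window_prime_factor:
  fixes s n :: nat
  assumes "n \<ge> 2" "k = 2 * n + 1" "s + k \<ge> 3 * k\<^sup>2 - 2 * k"
  shows "\<exists>p j. prime p \<and> p > k \<and> j < k \<and> p dvd s + 1 + j"
proof (rule ccontr)
  assume "\<not> ?thesis"
  hence smooth: "p \<le> k" if "prime p" "j < k" "p dvd s + 1 + j" for p j
    using that not_le by blast
  let ?N = "s + k" and ?S = "{p. prime p \<and> p \<le> k}"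
  let ?P = "ap_prod (s + 1) 1 k" and ?Q = "ap_prod 1 1 k"
  have "?P \<le> ?Q * (\<Prod>p\<in>?S. p ^ card (excess (s + 1) 1 1 k ?N p))"
  proof (rule ap_prod_le_excess)
    fix p :: nat assume p: "prime p" "p dvd ?P"
    then obtain j where "j < k" "p dvd s + 1 + j"
      unfolding ap_prod_def by (auto simp: prime_dvd_prod_iff)
    thus "p \<in> ?S" using p smooth by blast
  qed (use assms in auto)
  also have "(\<Prod>p\<in>?S. p ^ card (excess (s + 1) 1 1 k ?N p)) \<le> (\<Prod>p\<in>?S. ?N)"
    using assms by (intro prod_mono conjI excess_power_le) auto
  also have "\<dots> = ?N ^ card ?S" by (rule prod_constant)
  also have "\<dots> \<le> ?N ^ (n + 1)"
    using card_primes_le[of k] assms(1,2) by (intro power_increasing) auto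
  finally have PQ: "?P \<le> ?Q * ?N ^ (n + 1)" by simp
  have "?Q * ?N ^ k = (\<Prod>j<k. (1 + 1 * j) * ?N)"
    unfolding ap_prod_def prod.distrib by (simp only: prod_constant card_lessThan)
  also have "\<dots> \<le> (\<Prod>j<k. (s + 1 + 1 * j) * k)"
  proof (intro prod_mono conjI)
    fix j assume "j \<in> {..<k}"
    hence "(1 + j) * s \<le> k * s" by (intro mult_le_mono1) auto
    thus "(1 + 1 * j) * ?N \<le> (s + 1 + 1 * j) * k" by (simp add: algebra_simps)
  qed auto
  also have "\<dots> = ?P * k ^ k"
    unfolding ap_prod_def prod.distrib by (simp only: prod_constant card_lessThan)
  also have "\<dots> \<le> (?Q * ?N ^ (n + 1)) * k ^ k" by (intro mult_le_mono1 PQ)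
  finally have "?Q * (?N ^ k) \<le> ?Q * (?N ^ (n + 1) * k ^ k)" by (simp only: mult_ac)
  hence "?N ^ k \<le> ?N ^ (n + 1) * k ^ k" using ap_prod_pos[of 1 1 k] by simp
  moreover have "?N ^ k = ?N ^ (n + 1) * ?N ^ n"
    unfolding assms(2) power_add[symmetric] by (rule arg_cong[of _ _ "power _"]) simp
  ultimately have Nn: "?N ^ n \<le> k ^ k" using assms by simp
  \<comment> \<open>For \<open>k \<ge> 5\<close> the hypothesis gives \<open>N \<ge> 13 / 5 * k\<^sup>2\<close>.\<close>
  have "k * (13 * k) \<le> k * (5 * (3 * k - 2))" using assms by (intro mult_le_mono2) auto
  also have "\<dots> = 5 * (3 * k\<^sup>2 - 2 * k)"
    by (simp add: power2_eq_square right_diff_distrib' mult_ac)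
  also have "\<dots> \<le> 5 * ?N" using assms(3) by (rule mult_le_mono2)
  finally have "k * (13 * k) \<le> 5 * ?N" .
  hence "(k * (13 * k)) ^ n \<le> (5 * ?N) ^ n" by (intro power_mono) auto
  also have "\<dots> = 5 ^ n * ?N ^ n" by (rule power_mult_distrib)
  also have "\<dots> \<le> 5 ^ n * k ^ k" by (intro mult_le_mono2 Nn)
  also have "k ^ k = k ^ n * k ^ n * k" unfolding assms(2) by (simp add: power_add mult_2)
  finally have "(k ^ n * k ^ n) * 13 ^ n \<le> (k ^ n * k ^ n) * (5 ^ n * k)"
    by (simp only: power_mult_distrib mult_ac)
  hence "13 ^ n \<le> 5 ^ n * k" using assms by simp
  thus False using five_power_growth[OF assms(1)] assms(2) by simp
qed

section \<open>Integer zeros force integral coefficients\<close>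

text \<open>
  Integrality is expressed inside the field of coefficients, so that it can be transferred
  from complex to rational polynomials.
\<close>
definition int_coeffs :: "'a::comm_ring_1 poly \<Rightarrow> bool" where
  "int_coeffs p \<longleftrightarrow> (\<forall>i. coeff p i \<in> \<int>)"

lemma int_coeffs_1 [simp]: "int_coeffs 1"
  by (auto simp: int_coeffs_def)

lemma int_coeffs_mult: "int_coeffs p \<Longrightarrow> int_coeffs q \<Longrightarrow> int_coeffs (p * q)"
  unfolding int_coeffs_def coeff_mult by (auto intro!: Ints_sum Ints_mult)

lemma int_coeffs_smult: "c \<in> \<int> \<Longrightarrow> int_coeffs p \<Longrightarrow> int_coeffs (smult c p)"
  unfolding int_coeffs_def by (auto intro!: Ints_mult)

lemma int_coeffs_linear: "c \<in> \<int> \<Longrightarrow> int_coeffs [:c, 1:]"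
  unfolding int_coeffs_def by (auto simp: coeff_pCons split: nat.split)

lemma int_coeffs_prod: "(\<And>i. i \<in> A \<Longrightarrow> int_coeffs (f i)) \<Longrightarrow> int_coeffs (\<Prod>i\<in>A. f i)"
  by (induction A rule: infinite_finite_induct) (auto intro: int_coeffs_mult)

abbreviation X_ffact :: "nat \<Rightarrow> rat poly" where
  "X_ffact k \<equiv> ffact k [:0, 1:]"

lemma X_ffact_factor: "[:0, 1:] - of_nat j = [:- of_nat j, 1 :: rat:]"
  by (simp add: of_nat_poly)

lemma int_coeffs_X_ffact: "int_coeffs (X_ffact k)"
  unfolding ffact_def X_ffact_factor by (intro int_coeffs_prod int_coeffs_linear) auto

lemma degree_X_ffact: "degree (X_ffact k) = k"
  unfolding ffact_def X_ffact_factor by (subst degree_prod_sum_eq) auto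

lemma coeff_X_ffact: "coeff (X_ffact k) k = 1"
proof -
  have "lead_coeff (X_ffact k) = 1"
    unfolding ffact_def X_ffact_factor by (simp add: lead_coeff_prod)
  thus ?thesis by (simp add: degree_X_ffact)
qed

lemma degree_ffact_sum_le: "degree (\<Sum>k\<le>n. smult (c k) (X_ffact k)) \<le> n"
  by (intro degree_sum_le) (auto intro: order_trans[OF degree_smult_le] simp: degree_X_ffact)

lemma coeff_ffact_sum: "coeff (\<Sum>k\<le>n. smult (c k) (X_ffact k)) n = c n"
proof -
  have "coeff (\<Sum>k<n. smult (c k) (X_ffact k)) n = 0"
    by (simp add: coeff_sum coeff_eq_0 degree_X_ffact)
  thus ?thesis by (simp add: lessThan_Suc_atMost[symmetric] coeff_X_ffact)
qed

text \<open>
  The top coefficient of the polynomial is \<open>c n\<close>, because the falling factorials are monic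
  of increasing degree. Subtracting the top term leaves a polynomial with integer
  coefficients.
\<close>
lemma ffact_coefficients_Ints:
  assumes "int_coeffs (\<Sum>k\<le>n. smult (c k) (X_ffact k))" "k \<le> n"
  shows "c k \<in> \<int>"
  using assms
proof (induction n)
  case 0
  thus ?case by (auto simp: int_coeffs_def ffact_def dest: spec[of _ 0])
next
  case (Suc n)
  have top: "c (Suc n) \<in> \<int>"
    using Suc.prems(1) coeff_ffact_sum[of c "Suc n"] unfolding int_coeffs_def by metis
  show ?case
  proof (cases "k = Suc n")
    case False
    have "int_coeffs (smult (c (Suc n)) (X_ffact (Suc n)))"
      by (intro int_coeffs_smult top int_coeffs_X_ffact)
    hence "int_coeffs (\<Sum>k\<le>n. smult (c k) (X_ffact k))"
      using Suc.prems(1) unfolding int_coeffs_def by (auto simp: Ints_diff dest!: spec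
         intro: Ints_diff[of "_ + _" "coeff (smult (c (Suc n)) (X_ffact (Suc n))) _", simplified])
    thus ?thesis using Suc.IH Suc.prems False by simp
  qed (use top in simp)
qed

lemma int_coeffs_of_integer_roots:
  fixes P :: "complex poly"
  assumes "lead_coeff P \<in> \<int>" "\<And>z. poly P z = 0 \<Longrightarrow> z \<in> \<int>"
  shows "int_coeffs P"
proof -
  obtain root where P: "smult (lead_coeff P) (\<Prod>i<degree P. [:- root i, 1:]) = P"
    by (rule complex_poly_decompose')
  have "root i \<in> \<int>" if "i < degree P" for i
  proof -
    have "poly (smult (lead_coeff P) (\<Prod>i<degree P. [:- root i, 1:])) (root i) = 0"
      using that by (auto simp: poly_prod)
    thus ?thesis using assms(2) P by simp
  qed
  hence "int_coeffs (smult (lead_coeff P) (\<Prod>i<degree P. [:- root i, 1:]))"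
    using assms(1) by (intro int_coeffs_smult int_coeffs_prod int_coeffs_linear) auto
  thus ?thesis using P by simp
qed

lemma of_rat_in_Ints_iff: "(of_rat x :: complex) \<in> \<int> \<longleftrightarrow> x \<in> \<int>"
proof
  assume "(of_rat x :: complex) \<in> \<int>"
  then obtain n where "(of_rat x :: complex) = of_int n" by (auto elim: Ints_cases)
  hence "(of_rat x :: complex) = of_rat (of_int n)" by simp
  thus "x \<in> \<int>" by (simp only: of_rat_eq_iff) simp
qed (auto elim!: Ints_cases)

lemma Phi_ffact_sum:
  "Phi r s = (\<Sum>k\<le>s. smult ((-1) ^ k * pcoeff r s (s - k)) (X_ffact k))"
  unfolding Phi_def
  by (rule sum.reindex_bij_witness[of _ "\<lambda>k. s - k" "\<lambda>k. s - k"]) auto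

lemma pcoeff_0: "pcoeff r s 0 = 1"
  by (simp add: pcoeff_def ffact_def)

lemma pcoeff_in_Ints:
  assumes "\<And>z::complex. poly (map_poly of_rat (Phi r s)) z = 0 \<Longrightarrow> z \<in> \<int>" "i \<le> s"
  shows "pcoeff r s i \<in> \<int>"
proof -
  let ?P = "map_poly of_rat (Phi r s) :: complex poly"
  have top: "coeff (Phi r s) s = (-1) ^ s"
    unfolding Phi_ffact_sum coeff_ffact_sum by (simp add: pcoeff_0)
  have "degree (Phi r s) \<le> s"
    unfolding Phi_ffact_sum by (rule degree_ffact_sum_le)
  moreover have "s \<le> degree (Phi r s)" using top by (intro le_degree) simp
  ultimately have deg: "degree (Phi r s) = s" by simp
  have "degree ?P = s" using deg by (subst degree_map_poly) auto
  hence "lead_coeff ?P = (-1) ^ s" by (simp add: top coeff_map_poly of_rat_power)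
  hence "int_coeffs ?P" using assms(1) by (intro int_coeffs_of_integer_roots) auto
  hence "int_coeffs (Phi r s)"
    by (simp add: int_coeffs_def coeff_map_poly of_rat_in_Ints_iff)
  hence "(-1) ^ (s - i) * pcoeff r s (s - (s - i)) \<in> \<int>"
    unfolding Phi_ffact_sum by (rule ffact_coefficients_Ints) simp
  hence "(-1) ^ (s - i) * pcoeff r s i \<in> \<int>" using assms(2) by simp
  moreover have "(-1) ^ (s - i) \<in> (\<int> :: rat set)" by (intro Ints_power) simp
  ultimately have "(-1) ^ (s - i) * ((-1) ^ (s - i) * pcoeff r s i) \<in> \<int>"
    by (intro Ints_mult[of "(-1) ^ (s - i)" "(-1) ^ (s - i) * pcoeff r s i"])
  moreover have "(-1) ^ (s - i) * ((-1) ^ (s - i) * pcoeff r s i) = pcoeff r s i"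
    by (simp flip: mult.assoc power_mult_distrib)
  ultimately show ?thesis by (simp only:)
qed

section \<open>Residues excluded by integrality\<close>

text \<open>
  After multiplication by the denominators, integrality becomes the equation
  \<open>z * 2 ^ j * D = (s choose (2 * j)) * A * B\<close> of integers, where \<open>D\<close> is the product of
  the odd numbers from \<open>2 * r + 1\<close> to \<open>2 * r + 2 * j - 1\<close> and the factors of \<open>A\<close> and \<open>B\<close>
  are of the form \<open>r + l\<close>. The prime \<open>p\<close> divides the last factor of \<open>D\<close>.
\<close>
lemma pcoeff_even_dvd:
  assumes int: "pcoeff r s (2 * j) \<in> \<int>" and "j \<ge> 1" "prime p" "p dvd 2 * r + 2 * j - 1"
  shows "p dvd s choose (2 * j) \<or> (\<exists>l\<in>{1..2 * j}. p dvd r + l)"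
proof -
  let ?A = "\<Prod>t<j. r + 2 * j - 1 - t" and ?B = "\<Prod>t<2 * j. r + 1 + t"
  let ?D = "\<Prod>t<j. 2 * r + 1 + 2 * t"
  obtain z where z: "pcoeff r s (2 * j) = of_int z" using int by (auto elim: Ints_cases)
  have "ffact j (of_nat r + of_nat (2 * j) - 1 :: rat) = (\<Prod>t<j. of_nat (r + 2 * j - 1 - t))"
    unfolding ffact_def
  proof (rule prod.cong[OF refl])
    fix t assume "t \<in> {..<j}"
    hence "r + 2 * j - 1 - t + 1 + t = r + 2 * j" by simp
    hence "of_nat (r + 2 * j - 1 - t + 1 + t) = (of_nat (r + 2 * j) :: rat)" by (rule arg_cong)
    thus "of_nat r + of_nat (2 * j) - 1 - of_nat t = (of_nat (r + 2 * j - 1 - t) :: rat)"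
      by (simp add: algebra_simps del: of_nat_diff)
  qed
  hence A: "ffact j (of_nat r + of_nat (2 * j) - 1 :: rat) = of_nat ?A" by simp
  have B: "pochhammer (of_nat r + 1 :: rat) (2 * j) = of_nat ?B"
    unfolding pochhammer_prod by (simp add: atLeast0LessThan algebra_simps)
  have "pochhammer (of_nat r + 1 / 2 :: rat) j * 2 ^ j = (\<Prod>t<j. (of_nat r + 1 / 2 + of_nat t) * 2)"
    unfolding pochhammer_prod prod.distrib by (simp add: atLeast0LessThan)
  also have "\<dots> = of_nat ?D" by (simp add: algebra_simps)
  finally have D: "pochhammer (of_nat r + 1 / 2 :: rat) j * 2 ^ j = of_nat ?D" .
  have "pochhammer (of_nat r + 1 / 2 :: rat) j \<noteq> 0"
    unfolding pochhammer_prod by (simp add: add_nonneg_eq_0_iff)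
  hence "of_int z * (2 ^ (2 * j) * pochhammer (of_nat r + 1 / 2 :: rat) j)
          = of_nat (s choose (2 * j)) * (of_nat ?A * of_nat ?B)"
    unfolding z[symmetric] pcoeff_def A[symmetric] B[symmetric] by simp
  also have "2 ^ (2 * j) * pochhammer (of_nat r + 1 / 2 :: rat) j = 2 ^ j * of_nat ?D"
    unfolding D[symmetric] by (simp add: power_add mult_2)
  finally have "(of_int (z * 2 ^ j * int ?D) :: rat) = of_int (int ((s choose (2 * j)) * (?A * ?B)))"
    by simp
  hence eq: "z * 2 ^ j * int ?D = int ((s choose (2 * j)) * (?A * ?B))" by (simp only: of_int_eq_iff)
  have "2 * r + 2 * j - 1 = 2 * r + 1 + 2 * (j - 1)" using assms(2) by simp
  hence "p dvd ?D" using assms by (intro dvd_prodI[THEN dvd_trans[rotated], of _ "j - 1"]) auto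
  hence "int p dvd int ((s choose (2 * j)) * (?A * ?B))"
    unfolding eq[symmetric] by (intro dvd_mult) (simp only: int_dvd_int_iff)
  hence "p dvd (s choose (2 * j)) * (?A * ?B)" by (simp only: int_dvd_int_iff)
  then consider "p dvd s choose (2 * j)" | t where "t < j" "p dvd r + 2 * j - 1 - t"
    | t where "t < 2 * j" "p dvd r + 1 + t"
    using assms(3) by (auto simp: prime_dvd_mult_iff prime_dvd_prod_iff)
  thus ?thesis
  proof cases
    case (2 t)
    hence "r + 2 * j - 1 - t = r + (2 * j - 1 - t)" "2 * j - 1 - t \<in> {1..2 * j}" by auto
    thus ?thesis using 2 by metis
  next
    case (3 t)
    thus ?thesis by (intro disjI2 bexI[of _ "1 + t"]) auto
  qed auto
qed

text \<open>
  A simple case of Lucas' theorem: none of the factors \<open>s, s - 1, ..., s - i + 1\<close> in the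
  numerator is divisible by \<open>p\<close>.
\<close>
lemma not_prime_dvd_choose:
  fixes p :: nat
  assumes "prime p" "i \<le> s mod p"
  shows "\<not> p dvd s choose i"
  using assms(2)
proof (induction i)
  case 0
  thus ?case using assms(1) by auto
next
  case (Suc i)
  show ?case
  proof
    assume "p dvd s choose Suc i"
    hence "p dvd Suc i * (s choose Suc i)" by simp
    also have "Suc i * (s choose Suc i) = (s - i) * (s choose i)"
      by (metis Suc_times_binomial_eq binomial_absorb_comp binomial_absorption)
    finally have "p dvd s - i" using Suc assms(1) by (simp add: prime_dvd_mult_iff)
    moreover have "s - i = s div p * p + (s mod p - i)"
      using Suc.prems by (metis Nat.add_diff_assoc Suc_leD div_mult_mod_eq)
    ultimately have "p dvd s mod p - i" by (metis dvd_add_right_iff dvd_triv_right)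
    moreover have "s mod p < p" using assms(1) prime_gt_0_nat by simp
    ultimately show False using Suc.prems nat_dvd_not_less[of "s mod p - i" p] by simp
  qed
qed

text \<open>
  A common prime factor \<open>p\<close> of \<open>2 * r + d\<close> and \<open>r + l\<close> divides \<open>2 * l - d\<close>, which is odd,
  hence nonzero, and too small for \<open>p\<close>.
\<close>
lemma residue_constraint:
  assumes "prime p" "odd d" "p dvd 2 * r + d" "d + 4 \<le> p" "d + 1 \<le> s mod p"
  shows "pcoeff r s (d + 1) \<notin> \<int>"
proof
  assume int: "pcoeff r s (d + 1) \<in> \<int>"
  obtain k where k: "d = 2 * k + 1" using assms(2) oddE by blast
  have "p dvd s choose (2 * (k + 1)) \<or> (\<exists>l\<in>{1..2 * (k + 1)}. p dvd r + l)"
    using int assms k by (intro pcoeff_even_dvd) (auto simp: algebra_simps)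
  moreover have "\<not> p dvd s choose (2 * (k + 1))"
    using assms k by (intro not_prime_dvd_choose) auto
  ultimately obtain l where l: "1 \<le> l" "l \<le> d + 1" "p dvd r + l" using k by auto
  have "int p dvd int (2 * (r + l)) - int (2 * r + d)"
    using l(3) assms(3) by (intro dvd_diff) (simp_all only: int_dvd_int_iff dvd_mult)
  hence dvd: "int p dvd 2 * int l - int d" by simp
  moreover have "2 * int l - int d \<noteq> 0" using k by presburger
  ultimately have "int p \<le> \<bar>2 * int l - int d\<bar>" by (metis dvd_imp_le_int abs_of_nat)
  thus False using l(1,2) assms(4) by linarith
qed

text \<open>
  The denominator \<open>2 * r + 1\<close> is coprime to \<open>r + 1\<close>, and its common divisors with \<open>r + 2\<close>
  divide \<open>3\<close>.
\<close>
lemma odd_dvd_three_choose_two: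
  assumes "pcoeff r s 2 \<in> \<int>"
  shows "2 * r + 1 dvd 3 * (s choose 2)"
proof -
  obtain z where z: "pcoeff r s 2 = of_int z" using assms by (auto elim: Ints_cases)
  have nz: "(of_nat r + 1 / 2 :: rat) \<noteq> 0" by (simp add: add_nonneg_eq_0_iff)
  have "pcoeff r s 2 = of_nat (s choose 2) / 4 *
      ((of_nat r + 1) * ((of_nat r + 1) * (of_nat r + 2)) / (of_nat r + 1 / 2))"
    by (simp add: pcoeff_def ffact_def pochhammer_rec numeral_2_eq_2 algebra_simps)
  hence "pcoeff r s 2 * (2 * (2 * of_nat r + 1)) =
      of_nat (s choose 2) * ((of_nat r + 1) * ((of_nat r + 1) * (of_nat r + 2)))"
    using nz by (simp add: field_simps)
  hence "(of_int (z * (2 * (2 * int r + 1))) :: rat) =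
         of_int (int ((s choose 2) * ((r + 1) * ((r + 1) * (r + 2)))))"
    unfolding z by (simp add: algebra_simps)
  hence "z * (2 * (2 * int r + 1)) = int ((s choose 2) * ((r + 1) * ((r + 1) * (r + 2))))"
    by (simp only: of_int_eq_iff)
  hence "int (2 * r + 1) dvd int ((s choose 2) * ((r + 1) * ((r + 1) * (r + 2))))"
    by (metis dvd_triv_right dvd_mult of_nat_add of_nat_mult of_nat_1 of_nat_numeral)
  hence "2 * r + 1 dvd (r + 1) * ((r + 1) * ((s choose 2) * (r + 2)))"
    by (simp only: int_dvd_int_iff mult_ac)
  moreover have "coprime (2 * r + 1) (r + 1)"
  proof (rule coprimeI)
    fix c assume c: "c dvd 2 * r + 1" "c dvd r + 1"
    have "c dvd 2 * (r + 1) - (2 * r + 1)" by (intro dvd_diff_nat dvd_mult c)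
    thus "is_unit c" by simp
  qed
  ultimately have X: "2 * r + 1 dvd (s choose 2) * (r + 2)"
    by (metis coprime_dvd_mult_right_iff)
  have "2 * r + 1 dvd 2 * ((s choose 2) * (r + 2)) - (s choose 2) * (2 * r + 1)"
    by (rule dvd_diff_nat[OF dvd_mult[OF X] dvd_triv_right])
  also have "2 * ((s choose 2) * (r + 2)) - (s choose 2) * (2 * r + 1) = 3 * (s choose 2)"
    by (simp add: algebra_simps)
  finally show ?thesis .
qed

lemma pcoeff_1_Ints_imp_even:
  assumes "pcoeff r s 1 \<in> \<int>"
  shows "even (s * (r + 1))"
proof -
  obtain z where z: "pcoeff r s 1 = of_int z" using assms by (auto elim: Ints_cases)
  have "pcoeff r s 1 * 2 = of_nat (s * (r + 1))"
    by (simp add: pcoeff_def ffact_def algebra_simps)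
  hence "(of_int (z * 2) :: rat) = of_int (int (s * (r + 1)))" unfolding z by simp
  hence "z * 2 = int (s * (r + 1))" by (simp only: of_int_eq_iff)
  thus ?thesis by presburger
qed

text \<open>
  The coefficient that handles the exceptional window: \<open>25 * 27\<close> contains one factor \<open>3\<close>
  more than the numerator.
\<close>
lemma pcoeff_12_4_4: "pcoeff 12 4 4 \<notin> \<int>"
proof
  have "ffact 2 x = x * (x - 1)" "pochhammer x 2 = x * (x + 1)"
    "pochhammer x 4 = x * (x + 1) * (x + 2) * (x + 3)" for x :: rat
    by (simp_all add: ffact_def eval_nat_numeral pochhammer_Suc algebra_simps)
  hence "pcoeff 12 4 4 = 10192 / 3" by (simp add: pcoeff_def)
  moreover assume "pcoeff 12 4 4 \<in> \<int>"
  ultimately obtain z where "10192 / 3 = (of_int z :: rat)" by (auto elim: Ints_cases)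
  hence "(of_int 10192 :: rat) = of_int (3 * z)" by simp
  hence "10192 = 3 * z" by (simp only: of_int_eq_iff)
  thus False by presburger
qed

section \<open>Large prime factors of consecutive integers\<close>

lemma prime_factor_ge_5:
  fixes n :: nat
  assumes "odd n" "\<not> 3 dvd n" "n > 1"
  shows "\<exists>p. prime p \<and> 5 \<le> p \<and> p dvd n"
proof -
  obtain p where p: "prime p" "p dvd n" using prime_factor_nat[of n] assms(3) by auto
  have "p \<noteq> 2" "p \<noteq> 3" using p assms by auto
  moreover have "p \<noteq> 4" using p(1) by auto
  ultimately show ?thesis using p prime_ge_2_nat[OF p(1)] by (intro exI[of _ p]) auto
qed

text \<open>
  An odd number greater than \<open>1\<close> that is not divisible by \<open>3\<close> has a prime factor at least
  \<open>5\<close>. If \<open>s\<close> is even, one of \<open>s + 1\<close> and \<open>s + 3\<close> is such a number. If \<open>s\<close> is odd and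
  \<open>s + 2\<close> is a multiple of \<open>3\<close>, take half of the one among \<open>s + 1\<close> and \<open>s + 3\<close> that is not
  divisible by \<open>4\<close>.
\<close>
lemma three_consecutive_prime_factor:
  fixes s :: nat
  assumes "s \<ge> 4"
  shows "\<exists>p t. prime p \<and> 5 \<le> p \<and> 1 \<le> t \<and> t \<le> 3 \<and> p dvd s + t"
proof -
  have ex: ?thesis if "odd n" "\<not> 3 dvd n" "n > 1" "1 \<le> t" "t \<le> 3" "n dvd s + t" for n t
    using prime_factor_ge_5[OF that(1-3)] that(4-6) dvd_trans by blast
  have "(even s \<and> \<not> 3 dvd s + 1) \<or> (even s \<and> \<not> 3 dvd s + 3) \<or> (odd s \<and> \<not> 3 dvd s + 2) \<or>
    (\<exists>k. s + 1 = 2 * k \<and> odd k \<and> \<not> 3 dvd k) \<or> (\<exists>k. s + 3 = 2 * k \<and> odd k \<and> \<not> 3 dvd k)"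
    by presburger
  thus ?thesis
  proof (elim disjE exE conjE)
    assume "even s" "\<not> 3 dvd s + 1"
    thus ?thesis using assms by (intro ex[of "s + 1" 1]) auto
  next
    assume "even s" "\<not> 3 dvd s + 3"
    thus ?thesis using assms by (intro ex[of "s + 3" 3]) auto
  next
    assume "odd s" "\<not> 3 dvd s + 2"
    thus ?thesis using assms by (intro ex[of "s + 2" 2]) auto
  next
    fix k assume "s + 1 = 2 * k" "odd k" "\<not> 3 dvd k"
    thus ?thesis using assms by (intro ex[of k 1]) auto
  next
    fix k assume "s + 3 = 2 * k" "odd k" "\<not> 3 dvd k"
    thus ?thesis using assms by (intro ex[of k 3]) auto
  qed
qed

text \<open>
  A case of Sylvester's theorem. It is a consequence of Schur's theorem, since \<open>2 * r - 1\<close>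
  consecutive integers contain \<open>r - 1\<close> consecutive odd ones. For \<open>r = 2\<close> there would be
  only one odd number, and windows far from the origin are left to
  \<open>long_window_prime_factor\<close>.
\<close>
lemma window_prime_factor:
  fixes r s :: nat
  assumes "r \<ge> 2" "s \<ge> 2 * r - 1" "s \<ge> 4"
  shows "\<exists>p t. prime p \<and> p > 2 * r \<and> 1 \<le> t \<and> t \<le> 2 * r - 1 \<and> p dvd s + t"
proof (cases "r = 2")
  case True
  obtain p t where "prime p" "5 \<le> p" "1 \<le> t" "t \<le> 3" "p dvd s + t"
    using three_consecutive_prime_factor[OF assms(3)] by blast
  thus ?thesis using True by (intro exI[of _ p] exI[of _ t]) auto
next
  case False
  hence r: "r \<ge> 3" using assms(1) by simp
  define k where "k = 2 * r - 1"
  have k: "k = 2 * (r - 1) + 1" using r by (simp add: k_def)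
  have np: "\<not> prime (2 * r)" using r primes_dvd_imp_eq[of 2 "2 * r"] by auto
  have gt: "p > 2 * r" if "prime p" "p > 2 * r - 1" for p
    using that np by (cases "p = 2 * r") auto
  show ?thesis
  proof (cases "s + k \<ge> 3 * k\<^sup>2 - 2 * k")
    case True
    have "r - 1 \<ge> 2" using r by simp
    from long_window_prime_factor[OF this k True]
    obtain p j where "prime p" "p > k" "j < k" "p dvd s + 1 + j" by blast
    thus ?thesis using gt[of p] by (intro exI[of _ p] exI[of _ "1 + j"]) (auto simp: k_def)
  next
    case short: False
    \<comment> \<open>The first odd number after \<open>s\<close> is \<open>2 * a + 1\<close>.\<close>
    define m a where "m = r - 1" and "a = (s + 1) div 2"
    have m: "r = m + 1" "m \<ge> 2" using r by (auto simp: m_def)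
    have a: "s \<le> 2 * a" "2 * a \<le> s + 1" by (auto simp: a_def)
    show ?thesis
    proof (cases "m = 2 \<and> a = 12")
      case True
      \<comment> \<open>The primes \<open>29 = 24 + 5\<close> and \<open>13\<close>, with \<open>26 = 23 + 3\<close>, replace the missing prime.\<close>
      hence "s = 24 \<or> s = 23" "r = 3" using a m by auto
      thus ?thesis
        by (elim disjE) (rule exI[of _ 29], rule exI[of _ 5], simp, rule exI[of _ 13], rule exI[of _ 3], simp)
    next
      case False
      have "3 * k\<^sup>2 - 2 * k = 12 * m\<^sup>2 + 8 * m + 1"
        unfolding k m_def[symmetric] by (simp add: power2_eq_square algebra_simps)
      hence "2 * a + 2 * m - 1 \<le> 12 * m\<^sup>2 + 8 * m"
        using short a m unfolding k_def by linarith
      moreover have "a > m" using a assms(2) m by linarith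
      ultimately obtain p j where p: "prime p" "j < m" "p > 2 * m + 1" "p dvd 2 * a + 1 + 2 * j"
        using odd_window_prime_factor[of m a] m False by auto
      define t where "t = 2 * a + 1 + 2 * j - s"
      have "s + t = 2 * a + 1 + 2 * j" "1 \<le> t" "t \<le> 2 * r - 1"
        using a p(2) m by (auto simp: t_def)
      thus ?thesis using gt[of p] p m by (intro exI[of _ p] exI[of _ t]) auto
    qed
  qed
qed

section \<open>Only trivial parameters admit integer zeros\<close>

text \<open>
  The two ranges of \<open>s\<close> correspond to the two windows: the one following \<open>s\<close> and the one
  following \<open>2 * r\<close>.
\<close>
lemma no_integral_coefficients:
  fixes r s :: nat
  assumes int: "\<And>i. i \<le> s \<Longrightarrow> pcoeff r s i \<in> \<int>" and r: "r \<ge> 2" and s: "s \<ge> 2"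
  shows False
proof -
  have dvd2: "2 * r + 1 dvd 3 * (s choose 2)"
    using int s by (intro odd_dvd_three_choose_two) auto
  have ev: "even (s * (r + 1))" using int[of 1] s by (intro pcoeff_1_Ints_imp_even) auto
  consider "s = 2" | "s = 3" | "s \<ge> 4" "s \<ge> 2 * r - 1" | "s \<ge> 4" "s < 2 * r - 1"
    using s by linarith
  thus False
  proof cases
    case 1
    hence "2 * r + 1 \<le> 3" using dvd2 by (intro dvd_imp_le) auto
    thus False using r by simp
  next
    case 2
    hence d9: "2 * r + 1 dvd 9" using dvd2 by (simp add: choose_two)
    hence "2 * r + 1 \<le> 9" by (intro dvd_imp_le) auto
    hence "r = 2 \<or> r = 3 \<or> r = 4" using r by linarith
    thus False using ev 2 d9 by (elim disjE) simp_all
  next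
    case 3
    obtain p t where p: "prime p" "p > 2 * r" "1 \<le> t" "t \<le> 2 * r - 1" "p dvd s + t"
      using window_prime_factor[OF r 3(2,1)] by blast
    have "odd p" using p r by (subst odd_prime_nat_iff) auto
    define d where "d = p - 2 * r"
    have d: "p = 2 * r + d" "odd d" using p \<open>odd p\<close> by (auto simp: d_def)
    \<comment> \<open>Hence the residue is at least \<open>p - (2 * r - 1) = d + 1\<close>.\<close>
    have "s mod p = p - t"
    proof -
      obtain q where q: "s + t = p * q" using p by blast
      have "q > 0" using q p(3) by (cases q) auto
      hence "s = p * (q - 1) + (p - t)" using q p by (cases q) auto
      thus ?thesis using p by (metis mod_mult_self4 mod_less diff_less le_trans less_le_trans zero_less_one mult.commute add.commute prime_gt_0_nat)
    qed
    hence "d + 1 \<le> s mod p" using p d by linarith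
    moreover have "d + 1 \<le> s" using calculation mod_less_eq_dividend le_trans by blast
    ultimately show False
      using residue_constraint[of p d r s] int[of "d + 1"] p d r by auto
  next
    \<comment> \<open>Since \<open>p > 2 * m + 1 \<ge> s\<close>, the residue of \<open>s\<close> modulo \<open>p\<close> is \<open>s\<close> itself.\<close>
    case 4
    define m where "m = s div 2"
    have m: "m \<ge> 2" "2 * m \<le> s" "s \<le> 2 * m + 1" "m < r" using 4 by (auto simp: m_def)
    show False
    proof (cases "m = 2 \<and> r = 12")
      case True
      hence "s = 4 \<or> s = 5" using m by auto
      thus False using True ev int[of 4] pcoeff_12_4_4 by auto
    next
      case False
      have "2 * r + 1 \<le> 3 * (s choose 2)" using dvd2 s by (intro dvd_imp_le) auto
      also have "s choose 2 \<le> (2 * m + 1) * (2 * m) div 2"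
        unfolding choose_two using m by (intro div_le_mono mult_le_mono) auto
      also have "\<dots> = (2 * m + 1) * m" by simp
      finally have "2 * r + 1 \<le> 6 * m\<^sup>2 + 3 * m" by (simp add: power2_eq_square algebra_simps)
      hence "2 * r + 2 * m - 1 \<le> 12 * m\<^sup>2 + 8 * m" by linarith
      then obtain p j where p: "prime p" "j < m" "p > 2 * m + 1" "p dvd 2 * r + 1 + 2 * j"
        using odd_window_prime_factor[of m r] m False by auto
      have "p \<noteq> 2 * m + 2"
        using p(1,3) m(1) odd_prime_nat_iff[of p] by auto
      hence "2 * m + 3 \<le> p" using p(3) by presburger
      hence "2 * j + 5 \<le> p" using p(2) by simp
      moreover have "s mod p = s" using p m by simp
      moreover have "2 * j + 2 \<le> s" using p m by linarith
      ultimately show False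
        using residue_constraint[of p "2 * j + 1" r s] int[of "2 * j + 2"] p by (simp add: algebra_simps)
    qed
  qed
qed

theorem theorem1p6:
  fixes r s :: nat
  assumes "r > 0" and "s > 0"
    and "\<And>z::complex. poly (map_poly of_rat (Phi r s)) z = 0 \<Longrightarrow> z \<in> \<int>"
  shows "s = 1 \<or> r = 1 \<or> real s \<ge> 5000 * real r * (14.5 + ln (real r))\<^sup>2"
proof -
  have "\<not> (r \<ge> 2 \<and> s \<ge> 2)"
    using no_integral_coefficients pcoeff_in_Ints[OF assms(3)] by blast
  thus ?thesis using assms(1,2) by linarith
qed

end
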